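(* Let $V$ be a real separable Hilbert space and let $a,b,m$ be symmetric bilinear forms on $V$ such that $a$ is continuous and $V$-coercive, $b$ is weakly continuous, and $m$ is weakly continuous with $m(u,u)>0$ for all nonzero $u\in V$. Let $(\lambda_*,\mu_* )\in\sigma(a,b,m)$ be an eigenpoint of multiplicity $k_0\ge2$, and let $\mu_{n_0+1}(\lambda)\le\cdots\le\mu_{n_0+k_0}(\lambda)$ be the eigencurves intersecting at $(\lambda_*,\mu_* )$, i.e. $$\mu_{n_0}(\lambda_* )<\mu_*=\mu_{n_0+1}(\lambda_* )=\cdots=\mu_{n_0+k_0}(\lambda_* )<\mu_{n_0+k_0+1}(\lambda_* ).$$ For $1\le k\le k_0$ define $$b_k:=\min_{Z_k}\max_{0\ne v\in Z_k}\frac{-b(v,v)}{m(v,v)},$$ the minimum being over all $k$-dimensional subspaces $Z_k$ of the eigenspace $E_{\lambda_*\mu_*}$. Then for each $1\le k\le k_0$, $$\lim_{\lambda\to\lambda_*^-}\frac{\mu_{n_0+k}(\lambda)-\mu_*}{\lambda-\lambda_*}=b_{k_0-k+1}\qquad\text{and}\qquad\lim_{\lambda\to\lambda_*^+}\frac{\mu_{n_0+k}(\lambda)-\mu_*}{\lambda-\lambda_*}=b_k.$$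
   Context: "$a$ is continuous and $V$-coercive" means there are constants $0<\kappa_1\le\kappa_2<\infty$ with $\kappa_1\|u\|^2\le a(u,u)\le\kappa_2\|u\|^2$ for all $u\in V$. A symmetric bilinear form $b$ on $V$ is weakly continuous if $u_j\rightharpoonup u$ and $v_j\rightharpoonup v$ weakly in $V$ imply $b(u_j,v_j)\to b(u,v)$. A pair $(\lambda,\mu)\in\mathbb{R}^2$ is an eigenpoint of $(a,b,m)$ if there is a nonzero $u\in V$ with $a(u,v)=\lambda\,b(u,v)+\mu\,m(u,v)$ for all $v\in V$; $\sigma(a,b,m)$ is the set of eigenpoints; $E_{\lambda\mu}$ is the (finite-dimensional) eigenspace of all such $u$ together with $0$; the multiplicity of $(\lambda,\mu)$ is $\dim E_{\lambda\mu}$. For $\lambda\in\mathbb{R}$ and $n\in\mathbb{N}$ (with $n\le\dim V$ if $V$ is finite dimensional), $\mu_n(\lambda)$ is the $n$-th smallest, counted with multiplicity, of the real numbers $\mu$ for which $(\lambda,\mu)$ is an eigenpoint; equivalently $\mu_n(\lambda)=\inf_{Z_n}\sup_{0\ne v\in Z_n}\frac{a(v,v)-\lambda b(v,v)}{m(v,v)}$, the infimum being over all $n$-dimensional subspaces $Z_n$ of $V$. The $n$-th variational eigencurve is the graph of $\lambda\mapsto\mu_n(\lambda)$. If $n_0=0$ (or if $n_0+k_0=\dim V$) the corresponding outer strict inequality in the claim is omitted. *)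

theory Defs
  imports "HOL-Analysis.Analysis"
begin

text \<open>
  The Hilbert space is a type \<open>'v :: {real_inner, complete_space}\<close>; it may be finite or infinite
  dimensional. Since \<^term>\<open>dim\<close> is \<open>0\<close> on infinite-dimensional sets, \<open>dim Z = k\<close> with
  \<open>k \<ge> 1\<close> entails that \<open>Z\<close> is finite dimensional.
\<close>

definition finite_dimensional :: "'v::real_vector set \<Rightarrow> bool" where
  "finite_dimensional S \<longleftrightarrow> (\<exists>B. finite B \<and> S \<subseteq> span B)"

definition symmetric_bilinear :: "('v::real_vector \<Rightarrow> 'v \<Rightarrow> real) \<Rightarrow> bool" where
  "symmetric_bilinear c \<longleftrightarrow> bilinear c \<and> (\<forall>u v. c u v = c v u)"

definition continuous_coercive :: "('v::real_inner \<Rightarrow> 'v \<Rightarrow> real) \<Rightarrow> bool" where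
  "continuous_coercive a \<longleftrightarrow>
     (\<exists>\<kappa>1 \<kappa>2. 0 < \<kappa>1 \<and> \<kappa>1 \<le> \<kappa>2 \<and>
        (\<forall>u. \<kappa>1 * (norm u)\<^sup>2 \<le> a u u \<and> a u u \<le> \<kappa>2 * (norm u)\<^sup>2))"

definition weakly_tendsto :: "(nat \<Rightarrow> 'v::real_normed_vector) \<Rightarrow> 'v \<Rightarrow> bool" where
  "weakly_tendsto u l \<longleftrightarrow>
     (\<forall>f :: 'v \<Rightarrow> real. bounded_linear f \<longrightarrow> (\<lambda>j. f (u j)) \<longlonglongrightarrow> f l)"

definition weakly_continuous :: "('v::real_normed_vector \<Rightarrow> 'v \<Rightarrow> real) \<Rightarrow> bool" where
  "weakly_continuous c \<longleftrightarrow>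
     (\<forall>u v u' v'. weakly_tendsto u u' \<longrightarrow> weakly_tendsto v v' \<longrightarrow>
        (\<lambda>j. c (u j) (v j)) \<longlonglongrightarrow> c u' v')"

definition eigenpoints ::
    "('v::real_vector \<Rightarrow> 'v \<Rightarrow> real) \<Rightarrow> ('v \<Rightarrow> 'v \<Rightarrow> real) \<Rightarrow> ('v \<Rightarrow> 'v \<Rightarrow> real) \<Rightarrow> (real \<times> real) set"
  where
  "eigenpoints a b m =
     {(l, \<mu>). \<exists>u. u \<noteq> 0 \<and> (\<forall>v. a u v = l * b u v + \<mu> * m u v)}"

definition eigenspace ::
    "('v::real_vector \<Rightarrow> 'v \<Rightarrow> real) \<Rightarrow> ('v \<Rightarrow> 'v \<Rightarrow> real) \<Rightarrow> ('v \<Rightarrow> 'v \<Rightarrow> real) \<Rightarrow>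
      real \<times> real \<Rightarrow> 'v set"
  where
  "eigenspace a b m p = {u. \<forall>v. a u v = fst p * b u v + snd p * m u v}"

definition multiplicity_eigenpoint ::
    "('v::real_vector \<Rightarrow> 'v \<Rightarrow> real) \<Rightarrow> ('v \<Rightarrow> 'v \<Rightarrow> real) \<Rightarrow> ('v \<Rightarrow> 'v \<Rightarrow> real) \<Rightarrow>
      real \<times> real \<Rightarrow> nat"
  where
  "multiplicity_eigenpoint a b m p = dim (eigenspace a b m p)"

text \<open>
  \<open>eigencurve a b m n l\<close> is \<open>\<mu>\<^sub>n(l)\<close>, numbered from \<open>n = 1\<close>: the eigenvalue \<open>\<mu>\<close> such that
  fewer than \<open>n\<close> eigenvalues lie strictly below \<open>\<mu>\<close> and at least \<open>n\<close> lie at or below \<open>\<mu>\<close>, each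
  counted with its multiplicity. Sums over infinite sets are \<open>0\<close>, so for \<open>n \<ge> 1\<close> the second
  inequality also forces the set of eigenvalues at or below \<open>\<mu>\<close> to be finite.
\<close>

definition eigencurve ::
    "('v::real_vector \<Rightarrow> 'v \<Rightarrow> real) \<Rightarrow> ('v \<Rightarrow> 'v \<Rightarrow> real) \<Rightarrow> ('v \<Rightarrow> 'v \<Rightarrow> real) \<Rightarrow>
      nat \<Rightarrow> real \<Rightarrow> real"
  where
  "eigencurve a b m n l =
     (THE \<mu>. (l, \<mu>) \<in> eigenpoints a b m \<and>
        (\<Sum>\<nu> | (l, \<nu>) \<in> eigenpoints a b m \<and> \<nu> < \<mu>. multiplicity_eigenpoint a b m (l, \<nu>)) < n \<and>
        n \<le> (\<Sum>\<nu> | (l, \<nu>) \<in> eigenpoints a b m \<and> \<nu> \<le> \<mu>. multiplicity_eigenpoint a b m (l, \<nu>)))"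

text \<open>The indices \<open>n\<close> for which \<open>\<mu>\<^sub>n\<close> exists; the argument is the whole space \<open>V\<close>.\<close>

definition curve_index :: "'v::real_vector set \<Rightarrow> nat \<Rightarrow> bool" where
  "curve_index V n \<longleftrightarrow> 1 \<le> n \<and> (finite_dimensional V \<longrightarrow> n \<le> dim V)"

text \<open>
  On the reals, \<open>GREATEST\<close> and \<open>LEAST\<close> denote the attained maximum and minimum (they are unspecified
  if the extremum is not attained).
\<close>

definition max_quotient ::
    "('v::real_vector \<Rightarrow> 'v \<Rightarrow> real) \<Rightarrow> ('v \<Rightarrow> 'v \<Rightarrow> real) \<Rightarrow> 'v set \<Rightarrow> real"
  where
  "max_quotient b m Z = (GREATEST r. \<exists>v\<in>Z. v \<noteq> 0 \<and> r = - b v v / m v v)"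

definition minmax_quotient ::
    "('v::real_vector \<Rightarrow> 'v \<Rightarrow> real) \<Rightarrow> ('v \<Rightarrow> 'v \<Rightarrow> real) \<Rightarrow> 'v set \<Rightarrow> nat \<Rightarrow> real"
  where
  "minmax_quotient b m E k =
     (LEAST t. \<exists>Z. subspace Z \<and> Z \<subseteq> E \<and> dim Z = k \<and> t = max_quotient b m Z)"

end

theory Submission
  imports Defs "HOL-Complex_Analysis.Great_Picard"
begin

text \<open>
  For a real number \<open>l\<close> consider the form \<open>c\<^sub>l = a - l b\<close> relative to \<open>m\<close>. Since \<open>a\<close> is coercive and
  \<open>b\<close>, \<open>m\<close> are weakly continuous, minimising the quotient of \<open>c\<^sub>l\<close> and \<open>m\<close> again and again on
  \<open>m\<close>-orthogonal complements produces, for every level \<open>M\<close>, a finite \<open>m\<close>-orthonormal family of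
  eigenvectors with eigenvalues below \<open>M\<close> on whose complement \<open>c\<^sub>l \<ge> M m\<close>
  (\<open>spectral_frame_exists\<close>). Such a frame lists all eigenvalues below \<open>M\<close> with multiplicity, whence
  \<open>\<mu>\<^sub>n(l) < M\<close> if and only if a frame at level \<open>M\<close> has at least \<open>n\<close> members
  (\<open>eigencurve_less_iff\<close>). This replaces the minimax formula for the eigencurves: comparing a curve
  with a number becomes comparing the dimensions of two subspaces.

  Let \<open>E\<close> be the eigenspace at \<open>(\<lambda>\<^sub>*, \<mu>\<^sub>*)\<close>, and diagonalise \<open>-b\<close> on it by an \<open>m\<close>-orthonormal basis;
  \<open>b\<^sub>k\<close> is then the \<open>k\<close>-th smallest diagonal entry (\<open>minmax_quotient_eq\<close>). At the point
  \<open>(\<lambda>\<^sub>* + h, \<mu>\<^sub>* + h s)\<close> with \<open>h > 0\<close>, the form that decides the sign is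
  \<open>(a - \<lambda>\<^sub>* b - \<mu>\<^sub>* m) - h (b + s m)\<close>.
  If the curve \<open>\<mu>\<close> with index \<open>n\<^sub>0 + k\<close> lay on or above this point for a slope \<open>s > b\<^sub>k\<close> and a
  sequence of \<open>h\<close> tending to \<open>0\<close>, a dimension count would give vectors on which this form is nonnegative
  in the span of the \<open>n\<^sub>0\<close> lower eigenvectors and of basis vectors of \<open>E\<close> with entries up to
  \<open>b\<^sub>k\<close>. After normalisation they subconverge weakly to a nonzero vector in the span of
  these basis vectors on which \<open>b + s m\<close> is nonpositive, although it is positive definite there
  (\<open>no_sequence_above_slope\<close>). For a slope below \<open>b\<^sub>k\<close> the same is done in the complementary space
  (\<open>no_sequence_below_slope\<close>). Weak compactness thus does the work of a perturbation expansion.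

  The left derivatives follow by the reflection \<open>(\<lambda>, b) \<mapsto> (-\<lambda>, -b)\<close>, which reverses the order of the
  diagonal entries: the value at index \<open>k\<close> for \<open>-b\<close> is the negative of the one at index
  \<open>k\<^sub>0 - k + 1\<close> for \<open>b\<close> (\<open>minmax_quotient_minus\<close>).
\<close>

section \<open>Symmetric bilinear forms\<close>

lemma symmetric_bilinearD:
  assumes "symmetric_bilinear c"
  shows "bilinear c" "c u v = c v u"
  using assms by (auto simp: symmetric_bilinear_def)

lemma form_simps:
  assumes "symmetric_bilinear c"
  shows "c (x + y) z = c x z + c y z" "c z (x + y) = c z x + c z y"
    "c (x - y) z = c x z - c y z" "c z (x - y) = c z x - c z y"
    "c (r *\<^sub>R x) z = r * c x z" "c z (r *\<^sub>R x) = r * c z x"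
    "c 0 z = 0" "c z 0 = 0"
  using symmetric_bilinearD(1)[OF assms]
  by (auto simp: bilinear_ladd bilinear_radd bilinear_lsub bilinear_rsub bilinear_lmul bilinear_rmul
      bilinear_lzero bilinear_rzero)

lemma form_sum:
  assumes "symmetric_bilinear c"
  shows "c (\<Sum>i\<in>I. f i) y = (\<Sum>i\<in>I. c (f i) y)" "c y (\<Sum>i\<in>I. f i) = (\<Sum>i\<in>I. c y (f i))"
  using symmetric_bilinearD(1)[OF assms]
  by (auto simp: bilinear_def intro!: linear_sum linear_sum[of "\<lambda>x. c x y"])

lemma symmetric_bilinear_add:
  "symmetric_bilinear c \<Longrightarrow> symmetric_bilinear d \<Longrightarrow> symmetric_bilinear (\<lambda>u v. c u v + d u v)"
  by (auto simp: symmetric_bilinear_def bilinear_def linear_iff algebra_simps)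

lemma symmetric_bilinear_scale:
  "symmetric_bilinear c \<Longrightarrow> symmetric_bilinear (\<lambda>u v. r * c u v)"
  by (auto simp: symmetric_bilinear_def bilinear_def linear_iff algebra_simps)

lemma symmetric_bilinear_diff:
  "symmetric_bilinear c \<Longrightarrow> symmetric_bilinear d \<Longrightarrow> symmetric_bilinear (\<lambda>u v. c u v - d u v)"
  by (auto simp: symmetric_bilinear_def bilinear_def linear_iff algebra_simps)

lemma symmetric_bilinear_minus:
  "symmetric_bilinear c \<Longrightarrow> symmetric_bilinear (\<lambda>u v. - c u v)"
  by (auto simp: symmetric_bilinear_def bilinear_def linear_iff algebra_simps)

lemmas form_intros = symmetric_bilinear_add symmetric_bilinear_scale symmetric_bilinear_diff
  symmetric_bilinear_minus

text \<open>The first-variation argument in scalar form: at a minimum, the linear term of a quadratic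
  perturbation vanishes. It yields the Euler equations of all minimisers below.\<close>

lemma linear_coefficient_zero:
  fixes p d :: real
  assumes "\<And>s. 0 \<le> 2 * s * p + s\<^sup>2 * d"
  shows "p = 0"
proof (rule ccontr)
  assume "p \<noteq> 0"
  \<comment> \<open>Small enough for the linear term to dominate at \<open>s = - t p\<close>.\<close>
  define t where "t = 1 / (\<bar>d\<bar> + 1)"
  have t: "t > 0" "t * d < 1"
    by (auto simp: t_def divide_simps abs_if)
  have "0 \<le> 2 * (- t * p) * p + (- t * p)\<^sup>2 * d"
    by (rule assms)
  also have "\<dots> = t * p\<^sup>2 * (t * d - 2)"
    by (simp add: power2_eq_square algebra_simps)
  also have "\<dots> < 0"
    using t \<open>p \<noteq> 0\<close> by (intro mult_pos_neg mult_pos_pos) auto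
  finally show False by simp
qed

lemma form_null_on_subspace:
  assumes c: "symmetric_bilinear c" and S: "subspace S"
    and nonneg: "\<And>v. v \<in> S \<Longrightarrow> 0 \<le> c v v"
    and u: "u \<in> S" "c u u \<le> 0" and v: "v \<in> S"
  shows "c u v = 0"
proof (rule linear_coefficient_zero)
  fix s :: real
  have "0 \<le> c (u + s *\<^sub>R v) (u + s *\<^sub>R v)"
    using S u v by (intro nonneg) (simp add: subspace_add subspace_scale)
  also have "\<dots> = c u u + 2 * s * c u v + s\<^sup>2 * c v v"
    using symmetric_bilinearD(2)[OF c, of v u]
    by (simp add: form_simps[OF c] power2_eq_square algebra_simps)
  finally show "0 \<le> 2 * s * c u v + s\<^sup>2 * c v v" using u by linarith
qed

lemma form_Cauchy_Schwarz:
  assumes c: "symmetric_bilinear c" and nonneg: "\<And>v. 0 \<le> c v v"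
  shows "(c u v)\<^sup>2 \<le> c u u * c v v"
proof (cases "c v v = 0")
  case True
  then have "c v u = 0"
    using form_null_on_subspace[OF c subspace_UNIV, of v u] nonneg by simp
  then show ?thesis using True symmetric_bilinearD(2)[OF c, of v u] by simp
next
  case False
  then have pos: "c v v > 0" using nonneg[of v] by linarith
  have "0 \<le> c (c v v *\<^sub>R u - c u v *\<^sub>R v) (c v v *\<^sub>R u - c u v *\<^sub>R v)"
    by (rule nonneg)
  also have "\<dots> = c v v * (c u u * c v v - (c u v)\<^sup>2)"
    using symmetric_bilinearD(2)[OF c, of v u]
    by (simp add: form_simps[OF c] power2_eq_square algebra_simps)
  finally show ?thesis using pos by (simp add: zero_le_mult_iff)
qed

section \<open>Weak convergence in a separable Hilbert space\<close>

text \<open>Riesz representation: the functional \<open>f\<close> is represented by the minimiser of the energy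
  \<open>\<bar>x\<bar>\<^sup>2 / 2 - f x\<close>; the parallelogram identity makes every minimising sequence Cauchy.\<close>

lemma Riesz_representation:
  fixes f :: "'v::{real_inner, complete_space} \<Rightarrow> real"
  assumes f: "bounded_linear f"
  shows "\<exists>w. \<forall>x. f x = w \<bullet> x"
proof -
  interpret bounded_linear f by fact
  define J where "J x = (x \<bullet> x) / 2 - f x" for x
  obtain K where K: "\<And>x. norm (f x) \<le> norm x * K"
    using bounded by blast
  have low: "- (K\<^sup>2 / 2) \<le> J x" for x
  proof -
    have "f x \<le> norm x * K" using K[of x] by auto
    moreover have "0 \<le> (norm x - K)\<^sup>2" by simp
    ultimately show ?thesis
      by (simp add: J_def dot_square_norm power2_eq_square algebra_simps)
  qed
  define r where "r = Inf (range J)"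
  have bdd: "bdd_below (range J)" using low by (auto simp: bdd_below_def)
  have r_le: "r \<le> J x" for x unfolding r_def using bdd by (intro cInf_lower) auto
  have "\<exists>x. J x < r + inverse (real (Suc n))" for n
    using cInf_lessD[of "range J" "r + inverse (real (Suc n))"] by (auto simp: r_def)
  then obtain X where X: "\<And>n. J (X n) < r + inverse (real (Suc n))" by metis
  have half: "J ((1/2) *\<^sub>R (x + y)) = J x / 2 + J y / 2 - (norm (x - y))\<^sup>2 / 8" for x y
    by (simp add: J_def scaleR add power2_norm_eq_inner inner_add inner_diff inner_commute field_simps)
  have dist: "(norm (X i - X j))\<^sup>2 \<le> 8 * inverse (real (Suc N))" if "i \<ge> N" "j \<ge> N" for i j N
  proof -
    have "inverse (real (Suc i)) \<le> inverse (real (Suc N))" "inverse (real (Suc j)) \<le> inverse (real (Suc N))"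
      using that by (auto intro!: le_imp_inverse_le)
    then show ?thesis
      using half[of "X i" "X j"] r_le[of "(1/2) *\<^sub>R (X i + X j)"] X[of i] X[of j] by linarith
  qed
  have "Cauchy X"
    unfolding Cauchy_iff
  proof (intro allI impI)
    fix e :: real assume "e > 0"
    then obtain N where N: "inverse (real (Suc N)) < e\<^sup>2 / 8"
      using reals_Archimedean[of "e\<^sup>2 / 8"] by auto
    show "\<exists>M. \<forall>m\<ge>M. \<forall>n\<ge>M. norm (X m - X n) < e"
    proof (intro exI allI impI)
      fix i j assume "N \<le> i" "N \<le> j"
      then have "(norm (X i - X j))\<^sup>2 < e\<^sup>2" using dist[of N i j] N by linarith
      then show "norm (X i - X j) < e" using \<open>e > 0\<close> by (simp add: power_less_imp_less_base)
    qed
  qed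
  then obtain w where w: "X \<longlonglongrightarrow> w" by (auto simp: Cauchy_convergent_iff convergent_def)
  have lim: "(\<lambda>n. J (X n)) \<longlonglongrightarrow> J w"
    unfolding J_def by (intro tendsto_intros tendsto w) auto
  have "(\<lambda>n. r + inverse (real (Suc n))) \<longlonglongrightarrow> r + 0"
    by (intro tendsto_intros LIMSEQ_inverse_real_of_nat)
  then have "J w \<le> r + 0" by (rule LIMSEQ_le[OF lim]) (use X in \<open>blast intro: less_imp_le\<close>)
  then have Jw: "J w \<le> r" by simp
  have "f x = w \<bullet> x" for x
  proof -
    have "w \<bullet> x - f x = 0"
    proof (rule linear_coefficient_zero)
      fix s
      have "J w \<le> J (w + s *\<^sub>R x)" using Jw r_le order_trans by blast
      then show "0 \<le> 2 * s * (w \<bullet> x - f x) + s\<^sup>2 * (x \<bullet> x)"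
        by (simp add: J_def add scaleR inner_add inner_commute power2_eq_square field_simps)
    qed
    then show ?thesis by simp
  qed
  then show ?thesis by blast
qed

lemma weakly_tendsto_inner:
  "weakly_tendsto x l \<Longrightarrow> (\<lambda>j. x j \<bullet> y) \<longlonglongrightarrow> l \<bullet> (y :: 'v::real_inner)"
  unfolding weakly_tendsto_def by (drule spec[of _ "\<lambda>x. x \<bullet> y"]) (simp add: bounded_linear_inner_left)

lemma weakly_tendsto_const: "weakly_tendsto (\<lambda>_. l) l"
  by (simp add: weakly_tendsto_def)

text \<open>The values \<open>x j \<bullet> d\<close> on a countable dense set converge along a diagonal subsequence, hence on
  the whole space because \<open>x\<close> is bounded; Riesz representation then identifies the limit functional
  as a vector.\<close>

lemma bounded_weakly_compact:
  fixes x :: "nat \<Rightarrow> 'v::{real_inner, complete_space}"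
  assumes sep: "separable_space (euclidean :: 'v topology)"
    and bd: "\<And>j. norm (x j) \<le> 1"
  shows "\<exists>r l. strict_mono r \<and> weakly_tendsto (\<lambda>j. x (r j)) l"
proof -
  obtain D :: "'v set" where D: "countable D" "closure D = UNIV"
    using sep by (auto simp: separable_space_def)
  have 1: "norm (x n \<bullet> sgn d) \<le> 1" for n d
  proof -
    have "norm (x n \<bullet> sgn d) \<le> norm (x n) * norm (sgn d)"
      using Cauchy_Schwarz_ineq2[of "x n" "sgn d"] by simp
    also have "\<dots> \<le> 1 * 1" by (intro mult_mono) (use bd in \<open>auto simp: norm_sgn\<close>)
    finally show ?thesis by simp
  qed
  obtain r where r: "strict_mono r"
    and conv: "\<And>d. d \<in> D \<Longrightarrow> \<exists>l. (\<lambda>n. x (r n) \<bullet> sgn d) \<longlonglongrightarrow> l"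
    by (rule function_convergent_subsequence[OF D(1), of "\<lambda>n d. x n \<bullet> sgn d" 1])
       (use 1 in auto)
  have convD: "convergent (\<lambda>n. x (r n) \<bullet> d)" if d: "d \<in> D" for d
  proof -
    obtain l where "(\<lambda>n. x (r n) \<bullet> sgn d) \<longlonglongrightarrow> l" using conv[OF d] by blast
    then have "(\<lambda>n. norm d * (x (r n) \<bullet> sgn d)) \<longlonglongrightarrow> norm d * l" by (intro tendsto_intros)
    moreover have "norm d * (x (r n) \<bullet> sgn d) = x (r n) \<bullet> d" for n
      by (cases "d = 0") (auto simp: sgn_div_norm)
    ultimately show ?thesis by (auto simp: convergent_def)
  qed
  have conv: "convergent (\<lambda>n. x (r n) \<bullet> v)" for v
    unfolding Cauchy_convergent_iff[symmetric] Cauchy_iff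
  proof (intro allI impI)
    fix e :: real assume e: "e > 0"
    obtain d where d: "d \<in> D" "dist d v < e / 3"
      using D(2) e closure_approachable[of v D] by (metis UNIV_I divide_pos_pos zero_less_numeral)
    obtain N where N: "\<And>i j. i \<ge> N \<Longrightarrow> j \<ge> N \<Longrightarrow> norm (x (r i) \<bullet> d - x (r j) \<bullet> d) < e / 3"
      using convD[OF d(1)] e unfolding Cauchy_convergent_iff[symmetric] Cauchy_iff
      by (metis divide_pos_pos zero_less_numeral)
    have close: "\<bar>x i \<bullet> v - x i \<bullet> d\<bar> < e / 3" for i
    proof -
      have "\<bar>x i \<bullet> (v - d)\<bar> \<le> norm (x i) * norm (v - d)" by (rule Cauchy_Schwarz_ineq2)
      also have "\<dots> \<le> 1 * norm (v - d)" by (intro mult_right_mono bd) simp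
      finally show ?thesis using d(2) by (simp add: inner_diff_right dist_norm norm_minus_commute)
    qed
    show "\<exists>M. \<forall>i\<ge>M. \<forall>j\<ge>M. norm (x (r i) \<bullet> v - x (r j) \<bullet> v) < e"
    proof (intro exI allI impI)
      fix i j assume "N \<le> i" "N \<le> j"
      then show "norm (x (r i) \<bullet> v - x (r j) \<bullet> v) < e"
        using N[of i j] close[of "r i"] close[of "r j"] by (simp add: abs_if split: if_splits)
    qed
  qed
  define L where "L v = lim (\<lambda>n. x (r n) \<bullet> v)" for v
  have L: "(\<lambda>n. x (r n) \<bullet> v) \<longlonglongrightarrow> L v" for v
    using conv[of v] by (simp add: L_def convergent_LIMSEQ_iff)
  have "bounded_linear L"
  proof (rule bounded_linear_intro)
    show "L (u + v) = L u + L v" for u v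
      using tendsto_add[OF L[of u] L[of v]] L[of "u + v"]
      by (auto simp: inner_add_right intro: LIMSEQ_unique)
    show "L (c *\<^sub>R v) = c *\<^sub>R L v" for c v
      using tendsto_mult_left[OF L[of v], of c] L[of "c *\<^sub>R v"] by (auto intro: LIMSEQ_unique)
    show "norm (L v) \<le> norm v * 1" for v
    proof (rule LIMSEQ_le_const2[OF tendsto_norm[OF L]], intro exI allI impI)
      fix n
      have "norm (x (r n) \<bullet> v) \<le> norm (x (r n)) * norm v"
        using Cauchy_Schwarz_ineq2[of "x (r n)" v] by simp
      also have "\<dots> \<le> 1 * norm v" by (intro mult_right_mono bd) simp
      finally show "norm (x (r n) \<bullet> v) \<le> norm v * 1" by simp
    qed
  qed
  then obtain l where l: "\<And>v. L v = l \<bullet> v" using Riesz_representation by metis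
  have "weakly_tendsto (\<lambda>j. x (r j)) l"
    unfolding weakly_tendsto_def
  proof (intro allI impI)
    fix f :: "'v \<Rightarrow> real" assume "bounded_linear f"
    then obtain w where w: "\<And>v. f v = w \<bullet> v" using Riesz_representation by metis
    show "(\<lambda>j. f (x (r j))) \<longlonglongrightarrow> f l"
      using L[of w] by (simp add: w l inner_commute)
  qed
  then show ?thesis using r by blast
qed

text \<open>Sequential closedness suffices, as weak limits are taken along sequences only.\<close>

definition weakly_closed :: "'v::real_normed_vector set \<Rightarrow> bool" where
  "weakly_closed S \<longleftrightarrow> (\<forall>u l. (\<forall>j. u j \<in> S) \<longrightarrow> weakly_tendsto u l \<longrightarrow> l \<in> S)"

lemma weakly_closedD:
  "weakly_closed S \<Longrightarrow> (\<And>j. u j \<in> S) \<Longrightarrow> weakly_tendsto u l \<Longrightarrow> l \<in> S"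
  unfolding weakly_closed_def by blast

lemma weakly_continuousD:
  "weakly_continuous c \<Longrightarrow> weakly_tendsto u u' \<Longrightarrow> weakly_tendsto v v' \<Longrightarrow>
    (\<lambda>j. c (u j) (v j)) \<longlonglongrightarrow> c u' v'"
  unfolding weakly_continuous_def by blast

lemma weakly_continuous_left:
  "weakly_continuous c \<Longrightarrow> weakly_tendsto u u' \<Longrightarrow> (\<lambda>j. c (u j) v) \<longlonglongrightarrow> c u' v"
  using weakly_continuousD weakly_tendsto_const by fastforce

lemma weakly_continuous_add:
  "weakly_continuous c \<Longrightarrow> weakly_continuous d \<Longrightarrow> weakly_continuous (\<lambda>u v. c u v + d u v)"
  by (fastforce simp: weakly_continuous_def intro: tendsto_add)

lemma weakly_continuous_scale:
  "weakly_continuous c \<Longrightarrow> weakly_continuous (\<lambda>u v. r * c u v)"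
  by (fastforce simp: weakly_continuous_def intro: tendsto_mult_left)

lemma weakly_continuous_diff:
  "weakly_continuous c \<Longrightarrow> weakly_continuous d \<Longrightarrow> weakly_continuous (\<lambda>u v. c u v - d u v)"
  by (fastforce simp: weakly_continuous_def intro: tendsto_diff)

lemma weakly_continuous_minus:
  "weakly_continuous c \<Longrightarrow> weakly_continuous (\<lambda>u v. - c u v)"
  by (fastforce simp: weakly_continuous_def intro: tendsto_minus)

lemmas weakly_continuous_intros = weakly_continuous_add weakly_continuous_scale
  weakly_continuous_diff weakly_continuous_minus

section \<open>Orthonormal families\<close>

definition orthonormal_for :: "('v::real_vector \<Rightarrow> 'v \<Rightarrow> real) \<Rightarrow> 'v set \<Rightarrow> bool" where
  "orthonormal_for m B \<longleftrightarrow> (\<forall>x\<in>B. \<forall>y\<in>B. m x y = (if x = y then 1 else 0))"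

lemma orthonormal_forD:
  "orthonormal_for m B \<Longrightarrow> x \<in> B \<Longrightarrow> y \<in> B \<Longrightarrow> m x y = (if x = y then 1 else 0)"
  by (auto simp: orthonormal_for_def)

lemma orthonormal_for_subset: "orthonormal_for m B \<Longrightarrow> C \<subseteq> B \<Longrightarrow> orthonormal_for m C"
  unfolding orthonormal_for_def by blast

lemma orthonormal_for_combination:
  assumes m: "symmetric_bilinear m" and B: "finite B" "orthonormal_for m B" and e: "e \<in> B"
  shows "m (\<Sum>x\<in>B. f x *\<^sub>R x) e = f e"
proof -
  have "m (\<Sum>x\<in>B. f x *\<^sub>R x) e = (\<Sum>x\<in>B. if x = e then f x else 0)"
    using B(2) e by (auto simp: form_sum[OF m] form_simps[OF m] orthonormal_forD intro!: sum.cong)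
  then show ?thesis using B e by simp
qed

lemma orthonormal_for_independent:
  assumes m: "symmetric_bilinear m" and B: "finite B" "orthonormal_for m B"
  shows "independent B"
proof (rule independent_if_scalars_zero[OF B(1)])
  fix f x assume "(\<Sum>x\<in>B. f x *\<^sub>R x) = 0" "x \<in> B"
  then show "f x = 0"
    using orthonormal_for_combination[OF m B, of x f] by (simp add: form_simps[OF m])
qed

text \<open>The \<open>m\<close>-orthogonal projection onto the span of an \<open>m\<close>-orthonormal family.\<close>

definition proj :: "('v::real_vector \<Rightarrow> 'v \<Rightarrow> real) \<Rightarrow> 'v set \<Rightarrow> 'v \<Rightarrow> 'v" where
  "proj m B v = (\<Sum>e\<in>B. m v e *\<^sub>R e)"

lemma proj_in_span: "proj m B v \<in> span B"
  unfolding proj_def by (intro span_sum span_scale span_base)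

lemma proj_residual_orthogonal:
  assumes m: "symmetric_bilinear m" and B: "finite B" "orthonormal_for m B" and e: "e \<in> B"
  shows "m (v - proj m B v) e = 0"
  using orthonormal_for_combination[OF m B e] by (simp add: proj_def form_simps[OF m])

lemma orthogonal_to_span:
  assumes m: "symmetric_bilinear m" and "\<And>e. e \<in> B \<Longrightarrow> m v e = 0" and "x \<in> span B"
  shows "m v x = 0"
  using assms(3)
proof (induction rule: span_induct_alt)
  case base then show ?case by (simp add: form_simps[OF m])
next
  case (step c x y) then show ?case using assms(2) by (simp add: form_simps[OF m])
qed

lemma proj_span:
  assumes m: "symmetric_bilinear m" and pos: "\<And>u. u \<noteq> 0 \<Longrightarrow> m u u > 0"
    and B: "finite B" "orthonormal_for m B" and v: "v \<in> span B"
  shows "proj m B v = v"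
proof -
  have "v - proj m B v \<in> span B" using v proj_in_span by (rule span_diff)
  then have "m (v - proj m B v) (v - proj m B v) = 0"
    using proj_residual_orthogonal[OF m B] by (rule orthogonal_to_span[OF m, rotated])
  then show ?thesis using pos[of "v - proj m B v"] by fastforce
qed

text \<open>Orthogonality to a family \<open>B\<close> imposes \<open>card B\<close> linear conditions, so a space of larger dimension
  contains a nonzero solution: otherwise the orthogonal projection onto \<open>span B\<close> would be injective
  on it.\<close>

lemma exists_orthogonal_vector:
  assumes m: "symmetric_bilinear m" and B: "finite B" "orthonormal_for m B"
    and X: "independent X" "finite X" "card B < card X"
  shows "\<exists>v\<in>span X. v \<noteq> 0 \<and> (\<forall>e\<in>B. m v e = 0)"
proof -
  have lin: "linear (proj m B)"
    unfolding proj_def linear_iff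
    by (simp add: form_simps[OF m] scaleR_add_left sum.distrib scaleR_sum_right)
  have "\<not> inj_on (proj m B) (span X)"
  proof
    assume inj: "inj_on (proj m B) (span X)"
    then have ind: "independent (proj m B ` X)"
      using lin X(1) by (intro linear_independent_injective_image)
    have "card (proj m B ` X) = card X"
      using inj_on_subset[OF inj span_superset] by (rule card_image)
    moreover have "proj m B ` X \<subseteq> span B" by (auto simp: proj_in_span)
    then have "card (proj m B ` X) \<le> card B"
      using independent_span_bound[OF B(1) ind] by blast
    ultimately show False using X(3) by simp
  qed
  then obtain v where v: "v \<in> span X" "v \<noteq> 0" "proj m B v = 0"
    by (auto simp: linear_injective_on_subspace_0[OF lin subspace_span])
  have "m v e = 0" if "e \<in> B" for e
    using proj_residual_orthogonal[OF m B that, of v] v(3) by simp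
  then show ?thesis using v by blast
qed

section \<open>Compactness for a coercive form\<close>

locale coercive_pair =
  fixes a m :: "'v::{real_inner, complete_space} \<Rightarrow> 'v \<Rightarrow> real"
  assumes separable: "separable_space (euclidean :: 'v topology)"
    and sym_a: "symmetric_bilinear a" and sym_m: "symmetric_bilinear m"
    and coercive: "continuous_coercive a"
    and wc_m: "weakly_continuous m"
    and pos_m: "\<And>u. u \<noteq> 0 \<Longrightarrow> m u u > 0"
begin

lemma m_nonneg: "0 \<le> m u u"
  using pos_m[of u] by (cases "u = 0") (auto simp: form_simps[OF sym_m])

lemma m_le_0_iff: "m u u \<le> 0 \<longleftrightarrow> u = 0"
  using pos_m[of u] by (cases "u = 0") (auto simp: form_simps[OF sym_m])

lemma m_scaled_le: "r < s \<Longrightarrow> s * m u u \<le> r * m u u \<Longrightarrow> u = 0"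
  using pos_m[of u] mult_strict_right_mono[of r s "m u u"] by fastforce

lemma a_nonneg: "0 \<le> a u u"
proof -
  obtain \<kappa> where "0 < \<kappa>" "\<kappa> * (norm u)\<^sup>2 \<le> a u u"
    using coercive unfolding continuous_coercive_def by blast
  then show ?thesis by (meson order_trans mult_nonneg_nonneg less_imp_le zero_le_power2)
qed

lemma bounded_linear_a: "bounded_linear (\<lambda>u. a u v)"
proof -
  obtain K where K: "\<And>u. a u u \<le> K * (norm u)\<^sup>2" "0 < K"
    using coercive unfolding continuous_coercive_def by force
  show ?thesis
  proof (rule bounded_linear_intro)
    fix u
    have "(a u v)\<^sup>2 \<le> a u u * a v v"
      using form_Cauchy_Schwarz[OF sym_a a_nonneg] .
    also have "\<dots> \<le> (K * (norm u)\<^sup>2) * (K * (norm v)\<^sup>2)"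
      using K a_nonneg by (intro mult_mono) auto
    also have "\<dots> = (norm u * (K * norm v))\<^sup>2" by (simp add: power2_eq_square)
    finally show "norm (a u v) \<le> norm u * (K * norm v)"
      using K(2) by (simp add: abs_le_square_iff[symmetric] abs_mult)
  qed (simp_all add: form_simps[OF sym_a])
qed

lemma weakly_tendsto_a: "weakly_tendsto u l \<Longrightarrow> (\<lambda>j. a (u j) v) \<longlonglongrightarrow> a l v"
  using bounded_linear_a[of v] unfolding weakly_tendsto_def by blast

text \<open>Weak lower semicontinuity, from \<open>0 \<le> a (u\<^sub>j - l) (u\<^sub>j - l)\<close>.\<close>

lemma a_lower_semicontinuous:
  assumes u: "weakly_tendsto u l" and y: "y \<longlonglongrightarrow> t" and le: "\<And>j. a (u j) (u j) \<le> y j"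
  shows "a l l \<le> t"
proof -
  have "(\<lambda>j. 2 * a (u j) l - a l l) \<longlonglongrightarrow> 2 * a l l - a l l"
    by (intro tendsto_intros weakly_tendsto_a u)
  moreover have "2 * a (u j) l - a l l \<le> y j" for j
  proof -
    have "0 \<le> a (u j - l) (u j - l)" by (rule a_nonneg)
    also have "\<dots> = a (u j) (u j) - 2 * a (u j) l + a l l"
      using symmetric_bilinearD(2)[OF sym_a, of l "u j"] by (simp add: form_simps[OF sym_a])
    finally show ?thesis using le[of j] by linarith
  qed
  ultimately have "2 * a l l - a l l \<le> t" using y by (intro LIMSEQ_le) auto
  then show ?thesis by simp
qed

text \<open>The compactness principle behind every existence and limit argument below. Normalised vectors
  on which \<open>a\<close> is dominated by weakly continuous forms subconverge weakly to a limit which is not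
  zero, because coercivity keeps the dominating form bounded away from zero along the sequence.\<close>

lemma compactness_principle:
  assumes w: "weakly_continuous w" "symmetric_bilinear w"
    and d: "weakly_continuous d" "symmetric_bilinear d"
    and h: "h \<longlonglongrightarrow> 0"
    and nz: "\<And>j. v j \<noteq> 0"
    and le: "\<And>j. a (v j) (v j) \<le> w (v j) (v j) + h j * d (v j) (v j)"
  obtains r l where "strict_mono r" "weakly_tendsto (\<lambda>j. (1 / norm (v (r j))) *\<^sub>R v (r j)) l"
    "l \<noteq> 0" "a l l \<le> w l l"
proof -
  define x where "x j = (1 / norm (v j)) *\<^sub>R v j" for j
  have norm_x: "norm (x j) = 1" for j using nz[of j] by (simp add: x_def)
  obtain r l where r: "strict_mono r" and l: "weakly_tendsto (\<lambda>j. x (r j)) l"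
    using bounded_weakly_compact[OF separable, of x] norm_x by auto
  have le_x: "a (x j) (x j) \<le> w (x j) (x j) + h j * d (x j) (x j)" for j
  proof -
    have "(1 / norm (v j))\<^sup>2 * a (v j) (v j)
        \<le> (1 / norm (v j))\<^sup>2 * (w (v j) (v j) + h j * d (v j) (v j))"
      by (intro mult_left_mono le) simp
    then show ?thesis
      by (simp add: x_def form_simps[OF sym_a] form_simps[OF w(2)] form_simps[OF d(2)]
          power2_eq_square algebra_simps)
  qed
  have hr: "(\<lambda>j. h (r j)) \<longlonglongrightarrow> 0" using LIMSEQ_subseq_LIMSEQ[OF h r] by (simp add: o_def)
  have lim: "(\<lambda>j. w (x (r j)) (x (r j)) + h (r j) * d (x (r j)) (x (r j))) \<longlonglongrightarrow> w l l + 0 * d l l"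
    by (intro tendsto_intros hr weakly_continuousD[OF w(1)] weakly_continuousD[OF d(1)] l)
  have "a l l \<le> w l l + 0 * d l l"
    by (rule a_lower_semicontinuous[OF l lim]) (rule le_x)
  moreover obtain \<kappa> where \<kappa>: "0 < \<kappa>" "\<And>u. \<kappa> * (norm u)\<^sup>2 \<le> a u u"
    using coercive unfolding continuous_coercive_def by blast
  have "\<kappa> \<le> w (x (r j)) (x (r j)) + h (r j) * d (x (r j)) (x (r j))" for j
    using \<kappa>(2)[of "x (r j)"] le_x[of "r j"] by (simp add: norm_x)
  then have "\<kappa> \<le> w l l + 0 * d l l"
    by (intro LIMSEQ_le_const[OF lim]) auto
  then have "l \<noteq> 0" using \<kappa>(1) by (auto simp: form_simps[OF w(2)])
  ultimately show thesis using r l by (intro that[of r l]) (auto simp: x_def)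
qed

end

section \<open>Extremal vectors of quotients of forms\<close>

context coercive_pair
begin

text \<open>If the quotient of \<open>a - w\<close> and \<open>m\<close> were unbounded below, then along a normalised sequence
  \<open>m\<close> would tend to \<open>0\<close>, against the weak limit being nonzero.\<close>

lemma m_bounds_form_below:
  assumes w: "weakly_continuous w" "symmetric_bilinear w"
  shows "\<exists>s. \<forall>v. s * m v v \<le> a v v - w v v"
proof (rule ccontr)
  assume contr: "\<nexists>s. \<forall>v. s * m v v \<le> a v v - w v v"
  have "\<exists>v. a v v - w v v < - real (Suc n) * m v v" for n
    using contr by (meson not_le)
  then obtain v where v: "\<And>n. a (v n) (v n) - w (v n) (v n) < - real (Suc n) * m (v n) (v n)"
    by metis
  have nz: "v n \<noteq> 0" for n
    using v[of n] by (auto simp: form_simps[OF sym_a] form_simps[OF w(2)] form_simps[OF sym_m])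
  have dom: "a (v n) (v n) \<le> w (v n) (v n) + 0 * w (v n) (v n)" for n
  proof -
    have "0 \<le> real (Suc n) * m (v n) (v n)" by (intro mult_nonneg_nonneg m_nonneg) simp
    then show ?thesis using v[of n] by linarith
  qed
  obtain r l where r: "strict_mono r"
    and l: "weakly_tendsto (\<lambda>j. (1 / norm (v (r j))) *\<^sub>R v (r j)) l" "l \<noteq> 0" "a l l \<le> w l l"
    by (rule compactness_principle[OF w w tendsto_const nz dom])
  define x where "x j = (1 / norm (v (r j))) *\<^sub>R v (r j)" for j
  have x: "weakly_tendsto x l" using l(1) by (simp add: x_def[abs_def])
  have le: "m (x j) (x j) \<le> inverse (real (Suc (r j))) * w (x j) (x j)" for j
  proof -
    have "real (Suc (r j)) * m (v (r j)) (v (r j)) \<le> w (v (r j)) (v (r j))"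
      using v[of "r j"] a_nonneg[of "v (r j)"] by linarith
    then have "m (v (r j)) (v (r j)) \<le> inverse (real (Suc (r j))) * w (v (r j)) (v (r j))"
      by (simp add: field_simps)
    then have "(1 / norm (v (r j)))\<^sup>2 * m (v (r j)) (v (r j))
        \<le> (1 / norm (v (r j)))\<^sup>2 * (inverse (real (Suc (r j))) * w (v (r j)) (v (r j)))"
      by (intro mult_left_mono) auto
    then show ?thesis
      by (simp add: x_def form_simps[OF sym_m] form_simps[OF w(2)] power2_eq_square mult_ac)
  qed
  have "(\<lambda>j. inverse (real (Suc (r j)))) \<longlonglongrightarrow> 0"
    using LIMSEQ_subseq_LIMSEQ[OF LIMSEQ_inverse_real_of_nat r] by (simp add: o_def)
  then have "(\<lambda>j. inverse (real (Suc (r j))) * w (x j) (x j)) \<longlonglongrightarrow> 0 * w l l"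
    by (intro tendsto_mult weakly_continuousD[OF w(1)] x)
  then have "m l l \<le> 0 * w l l"
    by (rule LIMSEQ_le[OF weakly_continuousD[OF wc_m x x]]) (use le in blast)
  then show False using l(2) m_le_0_iff by auto
qed

text \<open>The infimum \<open>\<nu>\<close> is attained at the weak limit of a normalised minimising sequence; the excess over
  \<open>\<nu>\<close> is the term that is multiplied by a null sequence in the compactness principle.\<close>

lemma quotient_attains_minimum:
  assumes w: "weakly_continuous w" "symmetric_bilinear w"
    and S: "subspace S" "weakly_closed S" and u0: "u0 \<in> S" "u0 \<noteq> 0"
  obtains u \<nu> where "u \<in> S" "u \<noteq> 0" "a u u - w u u \<le> \<nu> * m u u"
    "\<And>v. v \<in> S \<Longrightarrow> \<nu> * m v v \<le> a v v - w v v"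
proof -
  define q where "q v = (a v v - w v v) / m v v" for v
  define Q where "Q = q ` (S - {0})"
  define \<nu> where "\<nu> = Inf Q"
  obtain s where s: "\<And>v. s * m v v \<le> a v v - w v v" using m_bounds_form_below[OF w] by blast
  have "bdd_below Q"
    unfolding bdd_below_def Q_def q_def
    by (rule exI[of _ s]) (use s pos_m in \<open>auto simp: divide_simps\<close>)
  have ne: "Q \<noteq> {}" using u0 by (auto simp: Q_def)
  have low: "\<nu> * m v v \<le> a v v - w v v" if v: "v \<in> S" for v
  proof (cases "v = 0")
    case True
    then show ?thesis by (simp add: form_simps[OF sym_a] form_simps[OF w(2)] form_simps[OF sym_m])
  next
    case False
    then have "\<nu> \<le> q v" unfolding \<nu>_def using v \<open>bdd_below Q\<close> by (intro cInf_lower) (auto simp: Q_def)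
    then show ?thesis using pos_m[OF False] by (simp add: q_def field_simps)
  qed
  have "\<exists>v\<in>S - {0}. q v < \<nu> + inverse (real (Suc n))" for n
    using cInf_lessD[OF ne, of "\<nu> + inverse (real (Suc n))"] by (auto simp: \<nu>_def Q_def)
  then obtain v where v: "\<And>n. v n \<in> S - {0}" "\<And>n. q (v n) < \<nu> + inverse (real (Suc n))" by metis
  have nz: "v n \<noteq> 0" for n using v(1) by auto
  let ?w = "\<lambda>x y. w x y + \<nu> * m x y"
  have w': "weakly_continuous ?w" "symmetric_bilinear ?w"
    by (intro weakly_continuous_intros w wc_m form_intros sym_m)+
  have dom: "a (v n) (v n) \<le> ?w (v n) (v n) + inverse (real (Suc n)) * m (v n) (v n)" for n
    using v(2)[of n] pos_m[OF nz[of n]] unfolding q_def by (subst (asm) pos_divide_less_eq) (auto simp: algebra_simps)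
  obtain r l where r: "strict_mono r"
    and l: "weakly_tendsto (\<lambda>j. (1 / norm (v (r j))) *\<^sub>R v (r j)) l" "l \<noteq> 0" "a l l \<le> ?w l l"
    by (rule compactness_principle[OF w' wc_m sym_m LIMSEQ_inverse_real_of_nat nz dom])
  have "l \<in> S" using S(2) _ l(1) by (rule weakly_closedD) (use v(1) S(1) subspace_scale in auto)
  then show thesis using l low by (intro that[of l \<nu>]) auto
qed

text \<open>What is asked of \<open>c\<close> is that it differ from \<open>a\<close> by a weakly continuous form, but only on the
  subspace \<open>S\<close>. This covers \<open>a - l b\<close> on the whole space as well as an arbitrary form on a
  finite-dimensional space, and so one spectral theorem serves for the eigencurves and for
  the minimax values on the eigenspace.\<close>

definition compact_perturbation :: "'v set \<Rightarrow> ('v \<Rightarrow> 'v \<Rightarrow> real) \<Rightarrow> bool" where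
  "compact_perturbation S c \<longleftrightarrow> (\<exists>w. weakly_continuous w \<and> symmetric_bilinear w \<and>
     (\<forall>u\<in>S. \<forall>v\<in>S. c u v = a u v - w u v))"

text \<open>A minimiser of the quotient is an eigenvector for the minimal value: the form
  \<open>c - \<nu> m\<close> is nonnegative on \<open>S\<close> and vanishes at it.\<close>

lemma minimal_eigenvector:
  assumes c: "symmetric_bilinear c" "compact_perturbation S c"
    and S: "subspace S" "weakly_closed S" and u0: "u0 \<in> S" "u0 \<noteq> 0"
  obtains u where "u \<in> S" "m u u = 1" "\<And>v. v \<in> S \<Longrightarrow> c u v = c u u * m u v"
    "\<And>v. v \<in> S \<Longrightarrow> c u u * m v v \<le> c v v"
proof -
  obtain w where w: "weakly_continuous w" "symmetric_bilinear w"
    and cw: "\<And>u v. u \<in> S \<Longrightarrow> v \<in> S \<Longrightarrow> c u v = a u v - w u v"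
    using c(2) unfolding compact_perturbation_def by blast
  obtain y \<nu> where y: "y \<in> S" "y \<noteq> 0" "a y y - w y y \<le> \<nu> * m y y"
    and low': "\<And>v. v \<in> S \<Longrightarrow> \<nu> * m v v \<le> a v v - w v v"
    by (rule quotient_attains_minimum[OF w S u0]) blast
  have cy: "c y y \<le> \<nu> * m y y" using y cw by simp
  have low: "\<nu> * m v v \<le> c v v" if "v \<in> S" for v using low'[OF that] cw that by simp
  let ?q = "\<lambda>u v. c u v - \<nu> * m u v"
  have q: "symmetric_bilinear ?q" by (intro form_intros c sym_m)
  define u where "u = (1 / sqrt (m y y)) *\<^sub>R y"
  have my: "m y y > 0" using y pos_m by blast
  have u: "u \<in> S" "m u u = 1" using S(1) y my
    by (auto simp: u_def subspace_scale form_simps[OF sym_m])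
  have "?q y v = 0" if "v \<in> S" for v
    by (rule form_null_on_subspace[OF q S(1)]) (use y cy low that in auto)
  then have eig: "c u v = \<nu> * m u v" if "v \<in> S" for v
    using that by (simp add: u_def form_simps[OF sym_m] form_simps[OF c(1)])
  then have "c u u = \<nu>" using u by simp
  then show thesis using u eig low by (intro that[of u]) auto
qed

section \<open>Spectral frames\<close>

text \<open>The eigenvalue of a member \<open>e\<close> of such an orthonormal family of eigenvectors of \<open>c\<close> relative to
  \<open>m\<close> on \<open>S\<close> is \<open>c e e\<close>, as \<open>m e e = 1\<close>.\<close>

definition partial_frame :: "('v \<Rightarrow> 'v \<Rightarrow> real) \<Rightarrow> 'v set \<Rightarrow> real \<Rightarrow> 'v set \<Rightarrow> bool" where
  "partial_frame c S M B \<longleftrightarrow> finite B \<and> B \<subseteq> S \<and> orthonormal_for m B \<and>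
     (\<forall>e\<in>B. c e e < M \<and> (\<forall>v\<in>S. c e v = c e e * m e v))"

text \<open>The second condition says that the family exhausts the spectrum below \<open>M\<close>.\<close>

definition spectral_frame :: "('v \<Rightarrow> 'v \<Rightarrow> real) \<Rightarrow> 'v set \<Rightarrow> real \<Rightarrow> 'v set \<Rightarrow> bool" where
  "spectral_frame c S M B \<longleftrightarrow> partial_frame c S M B \<and>
     (\<forall>v\<in>S. (\<forall>e\<in>B. m v e = 0) \<longrightarrow> M * m v v \<le> c v v)"

lemma partial_frameD:
  assumes "partial_frame c S M B"
  shows "finite B" "B \<subseteq> S" "orthonormal_for m B" "e \<in> B \<Longrightarrow> c e e < M"
    "e \<in> B \<Longrightarrow> v \<in> S \<Longrightarrow> c e v = c e e * m e v"
  using assms unfolding partial_frame_def by blast+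

lemma spectral_frameD:
  assumes "spectral_frame c S M B"
  shows "partial_frame c S M B" "v \<in> S \<Longrightarrow> (\<And>e. e \<in> B \<Longrightarrow> m v e = 0) \<Longrightarrow> M * m v v \<le> c v v"
  using assms unfolding spectral_frame_def by blast+

lemma weakly_closed_orthogonal_part:
  assumes "weakly_closed S"
  shows "weakly_closed {v \<in> S. \<forall>e\<in>B. m v e = 0}"
  unfolding weakly_closed_def
proof (intro allI impI)
  fix u l assume u: "\<forall>j. u j \<in> {v \<in> S. \<forall>e\<in>B. m v e = 0}" "weakly_tendsto u l"
  have "m l e = 0" if "e \<in> B" for e
  proof -
    have "(\<lambda>j. m (u j) e) \<longlonglongrightarrow> m l e" using wc_m u(2) by (rule weakly_continuous_left)
    moreover have "m (u j) e = 0" for j using u(1) that by blast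
    ultimately show ?thesis by (simp add: LIMSEQ_const_iff)
  qed
  moreover have "l \<in> S" using assms _ u(2) by (rule weakly_closedD) (use u(1) in blast)
  ultimately show "l \<in> {v \<in> S. \<forall>e\<in>B. m v e = 0}" by blast
qed

lemma subspace_orthogonal_part:
  assumes "subspace S"
  shows "subspace {v \<in> S. \<forall>e\<in>B. m v e = 0}"
  using assms by (auto simp: subspace_def form_simps[OF sym_m])

text \<open>If a family is not yet exhaustive, a minimiser of the quotient on its complement extends it. It
  is an eigenvector on all of \<open>S\<close>, because the form \<open>c\<close> couples it with no member of the family.\<close>

lemma partial_frame_extend:
  assumes c: "symmetric_bilinear c" "compact_perturbation S c"
    and S: "subspace S" "weakly_closed S"
    and B: "partial_frame c S M B" "\<not> spectral_frame c S M B"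
  shows "\<exists>u. u \<notin> B \<and> partial_frame c S M (insert u B)"
proof -
  note pB = partial_frameD[OF B(1)]
  define T where "T = {v \<in> S. \<forall>e\<in>B. m v e = 0}"
  have T: "subspace T" "weakly_closed T"
    unfolding T_def by (intro subspace_orthogonal_part weakly_closed_orthogonal_part S)+
  have cT: "compact_perturbation T c"
    using c(2) unfolding compact_perturbation_def T_def by blast
  obtain y where y: "y \<in> T" "c y y < M * m y y"
    using B unfolding spectral_frame_def T_def by force
  have "y \<noteq> 0" using y(2) by (auto simp: form_simps[OF c(1)] form_simps[OF sym_m])
  obtain u where u: "u \<in> T" "m u u = 1" "\<And>v. v \<in> T \<Longrightarrow> c u v = c u u * m u v"
    "\<And>v. v \<in> T \<Longrightarrow> c u u * m v v \<le> c v v"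
    by (rule minimal_eigenvector[OF c(1) cT T y(1) \<open>y \<noteq> 0\<close>]) blast
  have uB: "m u e = 0" "m e u = 0" if "e \<in> B" for e
    using u(1) that symmetric_bilinearD(2)[OF sym_m, of u e] by (auto simp: T_def)
  have uS: "u \<in> S" using u(1) by (simp add: T_def)
  have "u \<notin> B" using uB u(2) by fastforce
  have "c u u * m y y < M * m y y" using u(4)[OF y(1)] y(2) by linarith
  then have lt: "c u u < M" using pos_m[OF \<open>y \<noteq> 0\<close>] by simp
  have eig: "c u v = c u u * m u v" if v: "v \<in> S" for v
  proof -
    have PS: "proj m B v \<in> S"
      using proj_in_span span_minimal[OF pB(2) S(1)] by blast
    have "v - proj m B v \<in> T"
      using v PS S(1) proj_residual_orthogonal[OF sym_m pB(1,3)]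
      by (auto simp: T_def subspace_diff)
    then have "c u (v - proj m B v) = c u u * m u (v - proj m B v)" by (rule u(3))
    moreover have "m u (proj m B v) = 0"
      by (simp add: proj_def form_sum[OF sym_m] form_simps[OF sym_m] uB)
    moreover have "c u e = 0" if "e \<in> B" for e
      using pB(5)[OF that uS] uB[OF that] symmetric_bilinearD(2)[OF c(1), of u e] by simp
    then have "c u (proj m B v) = 0"
      by (simp add: proj_def form_sum[OF c(1)] form_simps[OF c(1)])
    ultimately show ?thesis by (simp add: form_simps[OF sym_m] form_simps[OF c(1)])
  qed
  have "orthonormal_for m (insert u B)"
    using pB(3) uB u(2) \<open>u \<notin> B\<close> unfolding orthonormal_for_def by auto
  moreover have "finite (insert u B)" "insert u B \<subseteq> S" using pB(1,2) uS by auto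
  moreover have "\<forall>e\<in>insert u B. c e e < M \<and> (\<forall>v\<in>S. c e v = c e e * m e v)"
    using pB(4,5) lt eig by blast
  ultimately show ?thesis using \<open>u \<notin> B\<close> unfolding partial_frame_def by blast
qed

text \<open>Extension must stop after finitely many steps: an infinite \<open>m\<close>-orthonormal sequence with
  bounded quotient would subconverge weakly to a nonzero vector that is \<open>m\<close>-orthogonal to the whole
  sequence, hence to itself.\<close>

lemma no_infinite_frame:
  assumes c: "compact_perturbation S c"
    and e: "\<And>i::nat. e i \<in> S" "\<And>i j. m (e i) (e j) = (if i = j then 1 else 0)"
    and bd: "\<And>i. c (e i) (e i) < M"
  shows False
proof -
  obtain w where w: "weakly_continuous w" "symmetric_bilinear w"
    and cw: "\<And>u v. u \<in> S \<Longrightarrow> v \<in> S \<Longrightarrow> c u v = a u v - w u v"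
    using c unfolding compact_perturbation_def by blast
  let ?w = "\<lambda>x y. w x y + M * m x y"
  have w': "weakly_continuous ?w" "symmetric_bilinear ?w"
    by (intro weakly_continuous_intros w wc_m form_intros sym_m)+
  have nz: "e i \<noteq> 0" for i using e(2)[of i i] by (auto simp: form_simps[OF sym_m])
  have dom: "a (e i) (e i) \<le> ?w (e i) (e i) + 0 * m (e i) (e i)" for i
    using bd[of i] cw[OF e(1) e(1), of i i] e(2)[of i i] by simp
  obtain r l where r: "strict_mono r"
    and l: "weakly_tendsto (\<lambda>j. (1 / norm (e (r j))) *\<^sub>R e (r j)) l" "l \<noteq> 0" "a l l \<le> ?w l l"
    by (rule compactness_principle[OF w' wc_m sym_m tendsto_const nz dom])
  define x where "x j = (1 / norm (e (r j))) *\<^sub>R e (r j)" for j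
  have x: "weakly_tendsto x l" using l(1) by (simp add: x_def[abs_def])
  have l_orth: "m l (e i) = 0" for i
  proof (rule LIMSEQ_unique[OF weakly_continuous_left[OF wc_m x]])
    have "m (x j) (e i) = 0" if "j > i" for j
    proof -
      have "r j > i" using that seq_suble[OF r, of j] by linarith
      then show ?thesis by (simp add: x_def form_simps[OF sym_m] e(2))
    qed
    then show "(\<lambda>j. m (x j) (e i)) \<longlonglongrightarrow> 0"
      by (intro tendsto_eventually) (auto simp: eventually_sequentially intro: exI[of _ "Suc i"])
  qed
  have "m (x j) l = 0" for j
    using l_orth[of "r j"] symmetric_bilinearD(2)[OF sym_m, of l "e (r j)"]
    by (simp add: x_def form_simps[OF sym_m])
  then have "m l l = 0"
    using weakly_continuous_left[OF wc_m x, of l] by (simp add: LIMSEQ_const_iff)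
  then show False using pos_m[OF l(2)] by simp
qed

text \<open>Otherwise the extension step could be iterated forever, contrary to the preceding lemma.\<close>

theorem spectral_frame_exists:
  assumes c: "symmetric_bilinear c" "compact_perturbation S c"
    and S: "subspace S" "weakly_closed S"
  shows "\<exists>B. spectral_frame c S M B"
proof (rule ccontr)
  assume "\<nexists>B. spectral_frame c S M B"
  then have "\<forall>B. partial_frame c S M B \<longrightarrow> (\<exists>u. u \<notin> B \<and> partial_frame c S M (insert u B))"
    using partial_frame_extend[OF c S] by blast
  then obtain ch where ch: "\<And>B. partial_frame c S M B \<Longrightarrow> ch B \<notin> B"
    "\<And>B. partial_frame c S M B \<Longrightarrow> partial_frame c S M (insert (ch B) B)" by metis
  define Bs where "Bs = rec_nat {} (\<lambda>_ B. insert (ch B) B)"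
  have Bs_Suc: "Bs (Suc n) = insert (ch (Bs n)) (Bs n)" for n by (simp add: Bs_def)
  have frames: "partial_frame c S M (Bs n)" for n
  proof (induction n)
    case 0 show ?case by (simp add: Bs_def partial_frame_def orthonormal_for_def)
  next
    case (Suc n) then show ?case using ch(2) by (simp add: Bs_Suc)
  qed
  define e where "e n = ch (Bs n)" for n
  have mono: "Bs i \<subseteq> Bs j" if "i \<le> j" for i j
    using that by (rule lift_Suc_mono_le[rotated]) (auto simp: Bs_Suc)
  have e_in: "e i \<in> Bs n" if "i < n" for i n
    using mono[of "Suc i" n] that by (auto simp: Bs_Suc e_def)
  have e_neq: "e i \<noteq> e j" if "i < j" for i j
    using e_in[OF that] ch(1)[OF frames[of j]] by (auto simp: e_def)
  have orth: "m (e i) (e j) = (if i = j then 1 else 0)" for i j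
  proof -
    define n where "n = Suc (max i j)"
    have "e i \<in> Bs n" "e j \<in> Bs n" by (auto simp: n_def intro: e_in)
    moreover have "e i = e j \<longleftrightarrow> i = j" using e_neq[of i j] e_neq[of j i] by (metis linorder_neqE_nat)
    ultimately show ?thesis
      using orthonormal_forD[OF partial_frameD(3)[OF frames[of n]]] by auto
  qed
  have "e i \<in> S" "c (e i) (e i) < M" for i
    using partial_frameD(2,4)[OF frames[of "Suc i"]] e_in[of i "Suc i"] by auto
  then show False using no_infinite_frame[OF c(2) _ orth] by blast
qed

text \<open>An eigenvector with eigenvalue below \<open>M\<close> minus its projection to the frame is again such an
  eigenvector, but it lies in the complement, where the quotient is at least \<open>M\<close>.\<close>

lemma eigenvector_in_frame_span:
  assumes c: "symmetric_bilinear c" and S: "subspace S" and B: "spectral_frame c S M B"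
    and u: "u \<in> S" "\<And>v. v \<in> S \<Longrightarrow> c u v = \<nu> * m u v" and \<nu>: "\<nu> < M"
  shows "u \<in> span {e \<in> B. c e e = \<nu>}"
proof -
  note pB = partial_frameD[OF spectral_frameD(1)[OF B]]
  have coeff: "m u e = 0 \<or> c e e = \<nu>" if e: "e \<in> B" for e
  proof -
    have "e \<in> S" using e pB(2) by blast
    then have "\<nu> * m u e = c e e * m e u"
      using u(2)[of e] pB(5)[OF e u(1)] symmetric_bilinearD(2)[OF c, of u e] by simp
    then show ?thesis using symmetric_bilinearD(2)[OF sym_m, of u e] by auto
  qed
  define p where "p = proj m B u"
  have pS: "p \<in> S" unfolding p_def using proj_in_span span_minimal[OF pB(2) S] by blast
  have cp: "c p v = \<nu> * m p v" if v: "v \<in> S" for v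
  proof -
    have "c p v = (\<Sum>e\<in>B. m u e * (c e e * m e v))"
      by (auto simp: p_def proj_def form_sum[OF c] form_simps[OF c] pB(5)[OF _ v] intro!: sum.cong)
    also have "\<dots> = (\<Sum>e\<in>B. \<nu> * (m u e * m e v))"
      using coeff by (intro sum.cong) auto
    also have "\<dots> = \<nu> * m p v"
      by (simp add: p_def proj_def form_sum[OF sym_m] form_simps[OF sym_m] sum_distrib_left)
    finally show ?thesis .
  qed
  have dS: "u - p \<in> S" using S u(1) pS by (rule subspace_diff)
  have "c (u - p) (u - p) = \<nu> * m (u - p) (u - p)"
    using u(2)[OF dS] cp[OF dS] by (simp add: form_simps(3)[OF c] form_simps(3)[OF sym_m] algebra_simps)
  moreover have "M * m (u - p) (u - p) \<le> c (u - p) (u - p)"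
    using dS proj_residual_orthogonal[OF sym_m pB(1,3)] unfolding p_def
    by (rule spectral_frameD(2)[OF B])
  ultimately have "u - p = 0" by (intro m_scaled_le[OF \<nu>]) linarith
  then have "u = (\<Sum>e\<in>B. m u e *\<^sub>R e)" by (simp add: p_def proj_def)
  moreover have "(\<Sum>e\<in>B. m u e *\<^sub>R e) \<in> span {e \<in> B. c e e = \<nu>}"
  proof (rule span_sum)
    fix e assume "e \<in> B"
    then show "m u e *\<^sub>R e \<in> span {e \<in> B. c e e = \<nu>}"
      using coeff[of e] by (auto intro: span_scale span_base span_zero)
  qed
  ultimately show ?thesis by simp
qed

text \<open>A vector of the span has coefficient \<open>m v e\<close> at \<open>e\<close>, and on \<open>e\<close> the form \<open>c\<close> is the multiple
  \<open>c e e\<close> of \<open>m\<close>.\<close>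

lemma frame_diagonal:
  assumes c: "symmetric_bilinear c" and S: "subspace S" and B: "partial_frame c S M B"
    and C: "C \<subseteq> B" and v: "v \<in> span C" and x: "x \<in> S"
  shows "c v x = (\<Sum>e\<in>C. c e e * m v e * m e x)" "m v x = (\<Sum>e\<in>C. m v e * m e x)"
proof -
  note pB = partial_frameD[OF B]
  have fC: "finite C" using C pB(1) by (rule finite_subset)
  have v_eq: "v = (\<Sum>e\<in>C. m v e *\<^sub>R e)"
    using proj_span[OF sym_m pos_m fC orthonormal_for_subset[OF pB(3) C] v] by (simp add: proj_def)
  have "c v x = (\<Sum>e\<in>C. m v e * c e x)"
    by (subst v_eq) (simp add: form_sum[OF c] form_simps[OF c])
  also have "\<dots> = (\<Sum>e\<in>C. c e e * m v e * m e x)"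
    using C pB(5)[OF _ x] by (intro sum.cong) auto
  finally show "c v x = (\<Sum>e\<in>C. c e e * m v e * m e x)" .
  show "m v x = (\<Sum>e\<in>C. m v e * m e x)"
    by (subst v_eq) (simp add: form_sum[OF sym_m] form_simps[OF sym_m])
qed

lemma frame_quadratic:
  assumes c: "symmetric_bilinear c" and S: "subspace S" and B: "partial_frame c S M B"
    and C: "C \<subseteq> B" and v: "v \<in> span C"
  shows "c v v = (\<Sum>e\<in>C. c e e * (m v e)\<^sup>2)" "m v v = (\<Sum>e\<in>C. (m v e)\<^sup>2)"
proof -
  have vS: "v \<in> S"
    using v C span_minimal[OF _ S, of C] partial_frameD(2)[OF B] by blast
  have sq: "m v e * m e v = (m v e)\<^sup>2" for e
    using symmetric_bilinearD(2)[OF sym_m, of e v] by (simp add: power2_eq_square)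
  show "c v v = (\<Sum>e\<in>C. c e e * (m v e)\<^sup>2)" "m v v = (\<Sum>e\<in>C. (m v e)\<^sup>2)"
    using frame_diagonal[OF c S B C v vS] by (simp_all add: sq mult.assoc)
qed

end

section \<open>Finite-dimensional subspaces\<close>

lemma symmetric_bilinear_inner: "symmetric_bilinear (\<lambda>u v :: 'v::real_inner. u \<bullet> v)"
  by (auto simp: symmetric_bilinear_def bilinear_def linear_iff inner_simps inner_commute)

text \<open>Coordinates with respect to an orthogonal spanning set; a zero vector in the set does no harm,
  because its coordinate is \<open>0 / 0 = 0\<close>.\<close>

lemma orthogonal_coordinates:
  fixes C :: "'v::real_inner set"
  assumes C: "finite C" "pairwise orthogonal C" and x: "x \<in> span C"
  shows "(\<Sum>e\<in>C. ((x \<bullet> e) / (e \<bullet> e)) *\<^sub>R e) = x"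
proof -
  define p where "p = (\<Sum>e\<in>C. ((x \<bullet> e) / (e \<bullet> e)) *\<^sub>R e)"
  have "(x - p) \<bullet> f = 0" if f: "f \<in> C" for f
  proof -
    have "p \<bullet> f = (\<Sum>e\<in>C. if e = f then x \<bullet> f else 0)"
      unfolding p_def inner_sum_left
      using C(2) f by (intro sum.cong) (auto simp: pairwise_def orthogonal_def)
    then show ?thesis using C(1) f by (simp add: inner_diff_left)
  qed
  moreover have "x - p \<in> span C"
    unfolding p_def by (intro span_diff[OF x] span_sum span_scale span_base)
  ultimately have "(x - p) \<bullet> (x - p) = 0"
    by (rule orthogonal_to_span[OF symmetric_bilinear_inner])
  then show ?thesis by (simp add: p_def)
qed

text \<open>The value \<open>t\<close> is the \<open>n\<close>-th smallest one of \<open>f\<close> with repetitions. Both the eigencurves and the minimax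
  values are recognised by this pair of counts.\<close>

lemma exists_value_with_count:
  fixes f :: "'b \<Rightarrow> real"
  assumes B: "finite B" and n: "1 \<le> n" "n \<le> card B"
  shows "\<exists>t\<in>f ` B. card {e \<in> B. f e < t} < n \<and> n \<le> card {e \<in> B. f e \<le> t}"
proof -
  define T where "T = {t \<in> f ` B. n \<le> card {e \<in> B. f e \<le> t}}"
  have ne: "B \<noteq> {}" using n by auto
  have fin: "finite T" using B by (simp add: T_def)
  have "{e \<in> B. f e \<le> Max (f ` B)} = B" using B by auto
  then have "Max (f ` B) \<in> T" using B ne n by (auto simp: T_def)
  then have min: "Min T \<in> T" "\<And>t. t \<in> T \<Longrightarrow> Min T \<le> t" using fin by (auto intro: Min_in)
  have "card {e \<in> B. f e < Min T} < n"
  proof (rule ccontr)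
    let ?L = "{e \<in> B. f e < Min T}"
    assume "\<not> card ?L < n"
    then have L: "n \<le> card ?L" by simp
    then have neL: "?L \<noteq> {}" using n by (metis card.empty not_one_le_zero order_trans)
    define s where "s = Max (f ` ?L)"
    have s: "s \<in> f ` ?L" unfolding s_def using B neL by (intro Max_in) auto
    have "?L \<subseteq> {e \<in> B. f e \<le> s}" using B by (auto simp: s_def)
    then have "n \<le> card {e \<in> B. f e \<le> s}" using L B card_mono[of "{e \<in> B. f e \<le> s}" ?L] by simp
    then have "s \<in> T" using s by (auto simp: T_def)
    then show False using min(2)[of s] s by auto
  qed
  then show ?thesis using min(1) by (auto simp: T_def)
qed

context coercive_pair
begin

text \<open>A finite-dimensional subspace carries no distinction between the strong and the weak topology:
  with \<open>P\<close> the orthogonal projection onto it, \<open>u, v \<mapsto> (a - c) (P u) (P v)\<close> is weakly continuous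
  whatever \<open>c\<close> is.\<close>

lemma finite_span_perturbation:
  assumes X: "finite X" and c: "symmetric_bilinear c"
  shows "compact_perturbation (span X) c" "weakly_closed (span X)"
proof -
  obtain C where C: "finite C" "span C = span X" "pairwise orthogonal C"
    using basis_orthogonal[OF X] by blast
  define P where "P x = (\<Sum>e\<in>C. ((x \<bullet> e) / (e \<bullet> e)) *\<^sub>R e)" for x
  have P: "P x = x" if "x \<in> span X" for x
    using orthogonal_coordinates[OF C(1,3), of x] that C(2) by (simp add: P_def)
  define g where "g u v = a u v - c u v" for u v
  have g: "symmetric_bilinear g" unfolding g_def by (intro form_intros sym_a c)
  define w where "w u v = g (P u) (P v)" for u v
  have w_eq: "w u v = (\<Sum>e\<in>C. (\<Sum>f\<in>C. (u \<bullet> e) / (e \<bullet> e) * ((v \<bullet> f) / (f \<bullet> f) * g e f)))" for u v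
    unfolding w_def P_def form_sum(1)[OF g] form_simps(5)[OF g]
    unfolding form_sum(2)[OF g] form_simps(6)[OF g] sum_distrib_left ..
  have P_lin: "P (x + y) = P x + P y" "P (r *\<^sub>R x) = r *\<^sub>R P x" for x y r
    by (simp_all add: P_def inner_add_left add_divide_distrib scaleR_add_left sum.distrib
        scaleR_sum_right)
  have "symmetric_bilinear w"
    using symmetric_bilinearD(2)[OF g]
    by (auto simp: symmetric_bilinear_def bilinear_def linear_iff w_def P_lin form_simps[OF g])
  moreover have "weakly_continuous w"
    unfolding weakly_continuous_def w_eq
    by (intro allI impI tendsto_sum tendsto_mult tendsto_const)
       (auto simp: divide_inverse intro!: tendsto_mult weakly_tendsto_inner)
  moreover have "c u v = a u v - w u v" if "u \<in> span X" "v \<in> span X" for u v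
    using that by (simp add: w_def P g_def)
  ultimately show "compact_perturbation (span X) c"
    unfolding compact_perturbation_def by blast
  show "weakly_closed (span X)"
    unfolding weakly_closed_def
  proof (intro allI impI)
    fix u l assume u: "\<forall>j. u j \<in> span X" "weakly_tendsto u l"
    have "l \<bullet> y = P l \<bullet> y" for y
    proof (rule LIMSEQ_unique[OF weakly_tendsto_inner[OF u(2)]])
      have "(\<lambda>j. P (u j) \<bullet> y) \<longlonglongrightarrow> P l \<bullet> y"
        unfolding P_def inner_sum_left inner_scaleR_left divide_inverse
        by (intro tendsto_sum tendsto_mult tendsto_const weakly_tendsto_inner u(2))
      then show "(\<lambda>j. u j \<bullet> y) \<longlonglongrightarrow> P l \<bullet> y" using P u(1) by simp
    qed
    then have "l = P l" by (metis vector_eq_rdot)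
    moreover have "P l \<in> span C" unfolding P_def by (intro span_sum span_scale span_base)
    ultimately show "l \<in> span X" using C(2) by simp
  qed
qed

lemma quotient_attains_maximum:
  assumes X: "finite X" and c: "symmetric_bilinear c" and u0: "u0 \<in> span X" "u0 \<noteq> 0"
  obtains u where "u \<in> span X" "m u u = 1" "\<And>v. v \<in> span X \<Longrightarrow> c v v \<le> c u u * m v v"
proof -
  let ?c = "\<lambda>u v. - c u v"
  have nc: "symmetric_bilinear ?c" by (intro form_intros c)
  obtain u where u: "u \<in> span X" "m u u = 1" "\<And>v. v \<in> span X \<Longrightarrow> - c u v = - c u u * m u v"
    and low: "\<And>v. v \<in> span X \<Longrightarrow> - c u u * m v v \<le> - c v v"
    by (rule minimal_eigenvector[OF nc finite_span_perturbation(1)[OF X nc] subspace_span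
          finite_span_perturbation(2)[OF X c] u0]) blast
  have "c v v \<le> c u u * m v v" if "v \<in> span X" for v using low[OF that] by simp
  then show thesis using u(1,2) by (rule that[rotated 2])
qed

text \<open>A form on a finite-dimensional space is diagonalised by a frame at a level above the maximum of
  its quotient: there the complement of the frame is trivial.\<close>

lemma diagonal_basis_exists:
  assumes X: "finite X" and c: "symmetric_bilinear c"
  obtains B M where "partial_frame c (span X) M B" "span B = span X"
proof (cases "\<exists>u0\<in>span X. u0 \<noteq> 0")
  case True
  then obtain u0 where u0: "u0 \<in> span X" "u0 \<noteq> 0" by blast
  obtain u where u: "\<And>v. v \<in> span X \<Longrightarrow> c v v \<le> c u u * m v v"
    by (rule quotient_attains_maximum[OF X c u0]) blast
  obtain B where B: "spectral_frame c (span X) (c u u + 1) B"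
    using spectral_frame_exists[OF c finite_span_perturbation(1)[OF X c] subspace_span
        finite_span_perturbation(2)[OF X c]] by blast
  note pB = partial_frameD[OF spectral_frameD(1)[OF B]]
  have "v \<in> span B" if v: "v \<in> span X" for v
  proof -
    let ?d = "v - proj m B v"
    have d: "?d \<in> span X"
      using v proj_in_span[of m B v] span_minimal[OF pB(2) subspace_span] by (blast intro: span_diff)
    have "(c u u + 1) * m ?d ?d \<le> c ?d ?d"
      using d proj_residual_orthogonal[OF sym_m pB(1,3)] by (rule spectral_frameD(2)[OF B])
    also have "\<dots> \<le> c u u * m ?d ?d" by (rule u[OF d])
    finally have "?d = 0" by (intro m_scaled_le[of "c u u" "c u u + 1"]) auto
    then show ?thesis using proj_in_span[of m B v] by simp
  qed
  then have "span B = span X" using span_minimal[OF pB(2) subspace_span] by blast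
  then show thesis using spectral_frameD(1)[OF B] by (rule that[rotated])
next
  case False
  then have "span X = {0}" using span_zero[of X] by blast
  then show thesis
    by (intro that[of 0 "{}"]) (auto simp: partial_frame_def orthonormal_for_def)
qed

section \<open>The minimax values on a finite-dimensional space\<close>

lemma max_quotient_eq:
  assumes u: "u \<in> Z" "m u u = 1" and max: "\<And>v. v \<in> Z \<Longrightarrow> - b v v \<le> - b u u * m v v"
  shows "max_quotient b m Z = - b u u"
  unfolding max_quotient_def
proof (rule Greatest_equality)
  have "u \<noteq> 0" using u(2) by (auto simp: form_simps[OF sym_m])
  then show "\<exists>v\<in>Z. v \<noteq> 0 \<and> - b u u = - b v v / m v v" using u by auto
next
  fix y assume "\<exists>v\<in>Z. v \<noteq> 0 \<and> y = - b v v / m v v"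
  then obtain v where v: "v \<in> Z" "v \<noteq> 0" "y = - b v v / m v v" by blast
  have "y * m v v = - b v v" using pos_m[OF v(2)] v(3) by simp
  then have "y * m v v \<le> - b u u * m v v" using max[OF v(1)] by linarith
  then show "y \<le> - b u u" using pos_m[OF v(2)] by (rule mult_right_le_imp_le)
qed

text \<open>In a basis that diagonalises \<open>-b\<close>, the \<open>k\<close>-th minimax value is the \<open>k\<close>-th smallest diagonal
  entry \<open>t\<close>: the value is attained on the span of \<open>k\<close> basis vectors with entries up to \<open>t\<close>, and every
  \<open>k\<close>-dimensional subspace contains a vector orthogonal to the fewer than \<open>k\<close> basis vectors with
  entries below \<open>t\<close>.\<close>

lemma minmax_quotient_eq:
  assumes b: "symmetric_bilinear b"
    and B: "partial_frame (\<lambda>u v. - b u v) E M B" "span B = E"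
    and t: "t \<in> (\<lambda>e. - b e e) ` B" "card {e \<in> B. - b e e < t} < k" "k \<le> card {e \<in> B. - b e e \<le> t}"
  shows "minmax_quotient b m E k = t"
  unfolding minmax_quotient_def
proof (rule Least_equality)
  note pB = partial_frameD[OF B(1)]
  have nb: "symmetric_bilinear (\<lambda>u v. - b u v)" by (intro form_intros b)
  have E: "subspace E" using B(2) by (metis subspace_span)
  obtain e0 where e0: "e0 \<in> B" "- b e0 e0 = t" using t(1) by auto
  let ?L = "{e \<in> B. - b e e \<le> t}"
  have "k - 1 \<le> card (?L - {e0})" using t(3) e0 pB(1) by (simp add: card_Diff_singleton)
  then obtain C' where C': "C' \<subseteq> ?L - {e0}" "card C' = k - 1" by (meson obtain_subset_with_card_n)
  \<comment> \<open>The entry \<open>t\<close> itself has to occur in \<open>C\<close>, for the maximum over its span to be \<open>t\<close>.\<close>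
  define C where "C = insert e0 C'"
  have fC': "finite C'" by (rule finite_subset[OF C'(1)]) (use pB(1) in simp)
  have C: "C \<subseteq> ?L" "card C = k" "finite C"
    using C' e0 t(2) fC' by (auto simp: C_def card_insert_if)
  have CB: "C \<subseteq> B" using C(1) by blast
  have "independent C"
    using orthonormal_for_independent[OF sym_m C(3) orthonormal_for_subset[OF pB(3) CB]] .
  then have dim: "dim (span C) = k" using dim_span_eq_card_independent[of C] C(2) by (simp del: dim_span)
  have spC: "span C \<subseteq> E" using CB B(2) span_mono by blast
  have "max_quotient b m (span C) = - b e0 e0"
  proof (rule max_quotient_eq)
    show "e0 \<in> span C" by (auto simp: C_def intro: span_base)
    show "m e0 e0 = 1" using orthonormal_forD[OF pB(3) e0(1) e0(1)] by simp
    fix v assume v: "v \<in> span C"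
    have "- b v v = (\<Sum>e\<in>C. - b e e * (m v e)\<^sup>2)"
      by (rule frame_quadratic(1)[OF nb E B(1) CB v])
    also have "\<dots> \<le> (\<Sum>e\<in>C. t * (m v e)\<^sup>2)"
      using C(1) by (intro sum_mono mult_right_mono) auto
    also have "\<dots> = t * m v v"
      by (simp add: frame_quadratic(2)[OF nb E B(1) CB v] sum_distrib_left)
    finally show "- b v v \<le> - b e0 e0 * m v v" using e0(2) by simp
  qed
  then show "\<exists>Z. subspace Z \<and> Z \<subseteq> E \<and> dim Z = k \<and> t = max_quotient b m Z"
    using dim spC e0(2) by (intro exI[of _ "span C"]) auto
next
  note pB = partial_frameD[OF B(1)]
  have nb: "symmetric_bilinear (\<lambda>u v. - b u v)" by (intro form_intros b)
  have E: "subspace E" using B(2) by (metis subspace_span)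
  fix y assume "\<exists>Z. subspace Z \<and> Z \<subseteq> E \<and> dim Z = k \<and> y = max_quotient b m Z"
  then obtain Z where Z: "subspace Z" "Z \<subseteq> E" "dim Z = k" "y = max_quotient b m Z" by blast
  obtain X where X: "X \<subseteq> Z" "independent X" "Z \<subseteq> span X" "card X = k"
    using basis_exists[of Z] Z(3) by metis
  have ZX: "Z = span X" using X(1,3) span_minimal[OF X(1) Z(1)] by blast
  have fX: "finite X" using X(4) t(2) by (metis card.infinite not_less_zero)
  let ?L = "{e \<in> B. - b e e < t}"
  have "\<exists>v\<in>span X. v \<noteq> 0 \<and> (\<forall>e\<in>?L. m v e = 0)"
    by (rule exists_orthogonal_vector[OF sym_m _ orthonormal_for_subset[OF pB(3)] X(2) fX])
       (use pB(1) t(2) X(4) in auto)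
  then obtain v where v: "v \<in> span X" "v \<noteq> 0" "\<And>e. e \<in> ?L \<Longrightarrow> m v e = 0" by blast
  have vB: "v \<in> span B" using v(1) ZX Z(2) B(2) by auto
  obtain u where u: "u \<in> span X" "m u u = 1" "\<And>v. v \<in> span X \<Longrightarrow> - b v v \<le> - b u u * m v v"
    by (rule quotient_attains_maximum[OF fX nb v(1,2)]) blast
  have y: "y = - b u u" using max_quotient_eq[of u Z b] u Z(4) ZX by blast
  have "t * m v v = (\<Sum>e\<in>B. t * (m v e)\<^sup>2)"
    by (simp add: frame_quadratic(2)[OF nb E B(1) order_refl vB] sum_distrib_left)
  also have "\<dots> \<le> (\<Sum>e\<in>B. - b e e * (m v e)\<^sup>2)"
  proof (rule sum_mono)
    fix e assume "e \<in> B"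
    then show "t * (m v e)\<^sup>2 \<le> - b e e * (m v e)\<^sup>2"
      using v(3)[of e] mult_right_mono[of t "- b e e" "(m v e)\<^sup>2"] by (cases "- b e e < t") auto
  qed
  also have "\<dots> = - b v v"
    by (rule frame_quadratic(1)[OF nb E B(1) order_refl vB, symmetric])
  also have "\<dots> \<le> y * m v v" using u(3)[OF v(1)] y by simp
  finally show "t \<le> y" using pos_m[OF v(2)] by simp
qed

text \<open>Replacing \<open>b\<close> by \<open>-b\<close> negates the diagonal entries and reverses their order.\<close>

lemma minmax_quotient_minus:
  assumes X: "finite X" and b: "symmetric_bilinear b" and k: "1 \<le> k" "k \<le> dim (span X)"
  shows "minmax_quotient (\<lambda>u v. - b u v) m (span X) k
    = - minmax_quotient b m (span X) (dim (span X) - k + 1)"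
proof -
  have nb: "symmetric_bilinear (\<lambda>u v. - b u v)" by (intro form_intros b)
  obtain B M where B: "partial_frame (\<lambda>u v. - b u v) (span X) M B" "span B = span X"
    by (rule diagonal_basis_exists[OF X nb])
  note pB = partial_frameD[OF B(1)]
  define k' where "k' = dim (span X) - k + 1"
  have card_B: "card B = dim (span X)"
    using dim_eq_card[of B "span X", unfolded span_span, OF B(2)
        orthonormal_for_independent[OF sym_m pB(1,3)]] by (rule sym)
  have "1 \<le> k'" "k' \<le> card B" using card_B k by (simp_all add: k'_def)
  then obtain t where t: "t \<in> (\<lambda>e. - b e e) ` B" "card {e \<in> B. - b e e < t} < k'"
    "k' \<le> card {e \<in> B. - b e e \<le> t}"
    using exists_value_with_count[OF pB(1), of k' "\<lambda>e. - b e e"] by blast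
  have compl: "card (B - L) = card B - card L" if "L \<subseteq> B" for L
    using that pB(1) by (meson card_Diff_subset finite_subset)
  have "{e \<in> B. - (- b e e) < - t} = B - {e \<in> B. - b e e \<le> t}" by auto
  then have lt: "card {e \<in> B. - (- b e e) < - t} < k"
    using compl[of "{e \<in> B. - b e e \<le> t}"] t(3) card_B k by (auto simp: k'_def)
  have "{e \<in> B. - (- b e e) \<le> - t} = B - {e \<in> B. - b e e < t}" by auto
  then have le: "k \<le> card {e \<in> B. - (- b e e) \<le> - t}"
    using compl[of "{e \<in> B. - b e e < t}"] t(2) card_B k by (auto simp: k'_def)
  have mem: "- t \<in> (\<lambda>e. - (- b e e)) ` B" using t(1) by force
  \<comment> \<open>The level only has to exceed every diagonal entry.\<close>
  have "partial_frame (\<lambda>u v. - (- b u v)) (span X) ((\<Sum>e\<in>B. \<bar>b e e\<bar>) + 1) B"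
    unfolding partial_frame_def
  proof (intro conjI ballI pB(1-3))
    fix e assume e: "e \<in> B"
    have "\<bar>b e e\<bar> \<le> (\<Sum>e\<in>B. \<bar>b e e\<bar>)" using e pB(1) by (intro member_le_sum) auto
    then show "- (- b e e) < (\<Sum>e\<in>B. \<bar>b e e\<bar>) + 1" by simp
    show "- (- b e v) = - (- b e e) * m e v" if "v \<in> span X" for v
      using pB(5)[OF e that] by simp
  qed
  then have "minmax_quotient (\<lambda>u v. - b u v) m (span X) k = - t"
    by (rule minmax_quotient_eq[OF nb _ B(2) mem lt le])
  moreover have "minmax_quotient b m (span X) k' = t"
    by (rule minmax_quotient_eq[OF b B t])
  ultimately show ?thesis by (simp add: k'_def)
qed

end

section \<open>Counting eigenvalues\<close>

locale eigencurve_problem = coercive_pair a m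
  for a m :: "'v::{real_inner, complete_space} \<Rightarrow> 'v \<Rightarrow> real" +
  fixes b :: "'v \<Rightarrow> 'v \<Rightarrow> real"
  assumes sym_b: "symmetric_bilinear b" and wc_b: "weakly_continuous b"
begin

definition shifted :: "real \<Rightarrow> 'v \<Rightarrow> 'v \<Rightarrow> real" where
  "shifted l u v = a u v - l * b u v"

lemma sym_shifted: "symmetric_bilinear (shifted l)"
  unfolding shifted_def[abs_def] by (intro form_intros sym_a sym_b)

lemma shifted_frame_exists: "\<exists>B. spectral_frame (shifted l) UNIV M B"
proof (rule spectral_frame_exists[OF sym_shifted _ subspace_UNIV])
  show "compact_perturbation UNIV (shifted l)"
    unfolding compact_perturbation_def shifted_def
    by (intro exI[of _ "\<lambda>u v. l * b u v"] conjI weakly_continuous_intros form_intros wc_b sym_b) simp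
qed (simp add: weakly_closed_def)

lemma mem_eigenspace: "u \<in> eigenspace a b m (l, \<nu>) \<longleftrightarrow> (\<forall>v. shifted l u v = \<nu> * m u v)"
  by (auto simp: eigenspace_def shifted_def algebra_simps)

lemma eigenpoint_iff: "(l, \<nu>) \<in> eigenpoints a b m \<longleftrightarrow> (\<exists>u\<in>eigenspace a b m (l, \<nu>). u \<noteq> 0)"
  by (auto simp: eigenspace_def eigenpoints_def)

lemma subspace_eigenspace: "subspace (eigenspace a b m p)"
  unfolding eigenspace_def subspace_def
  by (auto simp: form_simps[OF sym_a] form_simps[OF sym_b] form_simps[OF sym_m] algebra_simps)

lemma frame_member_eigenspace:
  assumes B: "spectral_frame (shifted l) UNIV M B" and e: "e \<in> B"
  shows "e \<in> eigenspace a b m (l, shifted l e e)" "e \<noteq> 0"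
proof -
  note pB = partial_frameD[OF spectral_frameD(1)[OF B]]
  show "e \<in> eigenspace a b m (l, shifted l e e)"
    unfolding mem_eigenspace using pB(5)[OF e] by blast
  show "e \<noteq> 0" using orthonormal_forD[OF pB(3) e e] by (auto simp: form_simps[OF sym_m])
qed

lemma eigenspace_eq_span:
  assumes B: "spectral_frame (shifted l) UNIV M B" and \<nu>: "\<nu> < M"
  shows "eigenspace a b m (l, \<nu>) = span {e \<in> B. shifted l e e = \<nu>}"
proof
  show "eigenspace a b m (l, \<nu>) \<subseteq> span {e \<in> B. shifted l e e = \<nu>}"
    using eigenvector_in_frame_span[OF sym_shifted subspace_UNIV B _ _ \<nu>] mem_eigenspace by auto
  have "{e \<in> B. shifted l e e = \<nu>} \<subseteq> eigenspace a b m (l, \<nu>)"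
    using frame_member_eigenspace(1)[OF B] by blast
  then show "span {e \<in> B. shifted l e e = \<nu>} \<subseteq> eigenspace a b m (l, \<nu>)"
    by (rule span_minimal[OF _ subspace_eigenspace])
qed

text \<open>Below the level of a frame, each eigenspace is spanned by the frame members that it contains, so
  that counting members counts eigenvalues with multiplicity.\<close>

lemma eigenvalue_count:
  assumes B: "spectral_frame (shifted l) UNIV M B" and P: "\<And>\<nu>. P \<nu> \<Longrightarrow> \<nu> < M"
  shows "(\<Sum>\<nu> | (l, \<nu>) \<in> eigenpoints a b m \<and> P \<nu>. multiplicity_eigenpoint a b m (l, \<nu>))
    = card {e \<in> B. P (shifted l e e)}"
proof -
  note pB = partial_frameD[OF spectral_frameD(1)[OF B]]
  let ?g = "\<lambda>e. shifted l e e" and ?B = "{e \<in> B. P (shifted l e e)}"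
  have set: "{\<nu>. (l, \<nu>) \<in> eigenpoints a b m \<and> P \<nu>} = ?g ` ?B"
  proof (intro set_eqI iffI)
    fix \<nu> assume "\<nu> \<in> {\<nu>. (l, \<nu>) \<in> eigenpoints a b m \<and> P \<nu>}"
    then obtain u where u: "u \<in> eigenspace a b m (l, \<nu>)" "u \<noteq> 0" and "P \<nu>"
      by (auto simp: eigenpoint_iff)
    then have "u \<in> span {e \<in> B. shifted l e e = \<nu>}" using eigenspace_eq_span[OF B P] by simp
    then have "{e \<in> B. shifted l e e = \<nu>} \<noteq> {}" using u(2) by (metis empty_iff insert_iff span_empty)
    then show "\<nu> \<in> ?g ` ?B" using \<open>P \<nu>\<close> by auto
  next
    fix \<nu> assume "\<nu> \<in> ?g ` ?B"
    then obtain e where e: "e \<in> B" "\<nu> = shifted l e e" "P \<nu>" by auto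
    have "e \<in> eigenspace a b m (l, \<nu>)" "e \<noteq> 0"
      using frame_member_eigenspace[OF B e(1)] e(2) by simp_all
    then show "\<nu> \<in> {\<nu>. (l, \<nu>) \<in> eigenpoints a b m \<and> P \<nu>}"
      using e(3) eigenpoint_iff by blast
  qed
  have mult: "multiplicity_eigenpoint a b m (l, \<nu>) = card {e \<in> ?B. ?g e = \<nu>}" if "P \<nu>" for \<nu>
  proof -
    let ?F = "{e \<in> B. ?g e = \<nu>}"
    have "independent ?F"
      using pB(1) by (intro orthonormal_for_independent[OF sym_m] orthonormal_for_subset[OF pB(3)]) auto
    then have "dim (span ?F) = card ?F" by (rule dim_span_eq_card_independent)
    moreover have "{e \<in> ?B. ?g e = \<nu>} = ?F" using that by auto
    ultimately show ?thesis
      using eigenspace_eq_span[OF B P[OF that]] by (simp add: multiplicity_eigenpoint_def del: dim_span)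
  qed
  have "card ?B = (\<Sum>\<nu>\<in>?g ` ?B. card {e \<in> ?B. ?g e = \<nu>})"
    using sum.image_gen[of ?B "\<lambda>_. 1 :: nat" ?g] pB(1) by simp
  also have "\<dots> = (\<Sum>\<nu>\<in>?g ` ?B. multiplicity_eigenpoint a b m (l, \<nu>))"
    by (intro sum.cong refl mult[symmetric]) auto
  finally show ?thesis by (simp add: set)
qed

text \<open>The two counts determine the value: for a smaller \<open>\<mu>\<close> too few eigenvalues lie at or below it, for a
  larger one too many lie strictly below.\<close>

lemma eigencurve_eq:
  assumes B: "spectral_frame (shifted l) UNIV M B" and t: "t \<in> (\<lambda>e. shifted l e e) ` B"
    and lt: "card {e \<in> B. shifted l e e < t} < n" and le: "n \<le> card {e \<in> B. shifted l e e \<le> t}"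
  shows "eigencurve a b m n l = t"
  unfolding eigencurve_def
proof (rule the_equality)
  note pB = partial_frameD[OF spectral_frameD(1)[OF B]]
  have tM: "t < M" using t pB(4) by auto
  have lt_eq: "(\<Sum>\<nu> | (l, \<nu>) \<in> eigenpoints a b m \<and> \<nu> < s. multiplicity_eigenpoint a b m (l, \<nu>))
      = card {e \<in> B. shifted l e e < s}" if "s \<le> t" for s
    by (rule eigenvalue_count[OF B]) (use that tM in auto)
  have le_eq: "(\<Sum>\<nu> | (l, \<nu>) \<in> eigenpoints a b m \<and> \<nu> \<le> s. multiplicity_eigenpoint a b m (l, \<nu>))
      = card {e \<in> B. shifted l e e \<le> s}" if "s \<le> t" for s
    by (rule eigenvalue_count[OF B]) (use that tM in auto)
  obtain e where e: "e \<in> B" "t = shifted l e e" using t by blast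
  have "(l, t) \<in> eigenpoints a b m"
    using frame_member_eigenspace[OF B e(1)] e(2) eigenpoint_iff by blast
  then show "(l, t) \<in> eigenpoints a b m \<and>
     (\<Sum>\<nu> | (l, \<nu>) \<in> eigenpoints a b m \<and> \<nu> < t. multiplicity_eigenpoint a b m (l, \<nu>)) < n \<and>
     n \<le> (\<Sum>\<nu> | (l, \<nu>) \<in> eigenpoints a b m \<and> \<nu> \<le> t. multiplicity_eigenpoint a b m (l, \<nu>))"
    using lt le lt_eq[of t] le_eq[of t] by simp
  fix \<mu>
  assume \<mu>: "(l, \<mu>) \<in> eigenpoints a b m \<and>
     (\<Sum>\<nu> | (l, \<nu>) \<in> eigenpoints a b m \<and> \<nu> < \<mu>. multiplicity_eigenpoint a b m (l, \<nu>)) < n \<and>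
     n \<le> (\<Sum>\<nu> | (l, \<nu>) \<in> eigenpoints a b m \<and> \<nu> \<le> \<mu>. multiplicity_eigenpoint a b m (l, \<nu>))"
  show "\<mu> = t"
  proof (rule ccontr)
    assume "\<mu> \<noteq> t"
    then consider "\<mu> < t" | "t < \<mu>" by linarith
    then show False
    proof cases
      case 1
      then have "{e \<in> B. shifted l e e \<le> \<mu>} \<subseteq> {e \<in> B. shifted l e e < t}" by auto
      then have "card {e \<in> B. shifted l e e \<le> \<mu>} \<le> card {e \<in> B. shifted l e e < t}"
        using pB(1) by (intro card_mono) auto
      then show False using \<mu> le_eq[of \<mu>] 1 lt by simp
    next
      case 2
      let ?S = "\<lambda>s. {\<nu>. (l, \<nu>) \<in> eigenpoints a b m \<and> \<nu> \<le> s}"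
      \<comment> \<open>A sum over an infinite set would be \<open>0\<close>, which is less than \<open>n\<close>.\<close>
      have "finite (?S \<mu>)"
      proof (rule ccontr)
        assume "infinite (?S \<mu>)"
        then show False using \<mu> lt by simp
      qed
      then have fin: "finite {\<nu>. (l, \<nu>) \<in> eigenpoints a b m \<and> \<nu> < \<mu>}"
        by (rule rev_finite_subset) auto
      have "(\<Sum>\<nu>\<in>?S t. multiplicity_eigenpoint a b m (l, \<nu>))
        \<le> (\<Sum>\<nu> | (l, \<nu>) \<in> eigenpoints a b m \<and> \<nu> < \<mu>. multiplicity_eigenpoint a b m (l, \<nu>))"
        by (rule sum_mono2[OF fin]) (use 2 in auto)
      then show False using \<mu> le le_eq[of t] by simp
    qed
  qed
qed

lemma exists_independent_of_card:
  assumes "curve_index (UNIV :: 'v set) n"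
  shows "\<exists>X :: 'v set. independent X \<and> finite X \<and> card X = n"
proof -
  obtain Y :: "'v set" where Y: "Y \<subseteq> UNIV" "independent Y" "UNIV \<subseteq> span Y"
    "card Y = dim (UNIV :: 'v set)"
    by (rule basis_exists)
  show ?thesis
  proof (cases "finite Y")
    case True
    then have "finite_dimensional (UNIV :: 'v set)"
      unfolding finite_dimensional_def using Y(3) by blast
    then have "n \<le> card Y" using assms Y(4) by (simp add: curve_index_def)
    then obtain X where "X \<subseteq> Y" "card X = n" "finite X" by (meson obtain_subset_with_card_n)
    then show ?thesis using Y(2) independent_mono by blast
  next
    case False
    then obtain X where "X \<subseteq> Y" "card X = n" "finite X"
      by (meson infinite_arbitrarily_large)
    then show ?thesis using Y(2) independent_mono by blast
  qed
qed

text \<open>The level \<open>M\<close> is compared with a level at or above it whose frame has at least \<open>n\<close> members, so that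
  it determines the \<open>n\<close>-th eigenvalue. Such a level exists because on any \<open>n\<close>-dimensional subspace
  the quotient is bounded, and for a level above the bound this subspace meets the complement of the
  frame only in \<open>0\<close>.\<close>

lemma eigencurve_less_iff:
  assumes n: "curve_index (UNIV :: 'v set) n" and B: "spectral_frame (shifted l) UNIV M B"
  shows "eigencurve a b m n l < M \<longleftrightarrow> n \<le> card B"
proof -
  have n1: "1 \<le> n" using n by (simp add: curve_index_def)
  obtain X :: "'v set" where X: "independent X" "finite X" "card X = n"
    using exists_independent_of_card[OF n] by blast
  obtain x0 where "x0 \<in> X" using X n1 by fastforce
  then have x0: "x0 \<in> span X" "x0 \<noteq> 0" using X(1) dependent_zero by (auto intro: span_base)
  obtain y where y: "\<And>v. v \<in> span X \<Longrightarrow> shifted l v v \<le> shifted l y y * m v v"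
    by (rule quotient_attains_maximum[OF X(2) sym_shifted x0]) blast
  define M' where "M' = max M (shifted l y y + 1)"
  obtain B' where B': "spectral_frame (shifted l) UNIV M' B'" using shifted_frame_exists by blast
  note pB' = partial_frameD[OF spectral_frameD(1)[OF B']]
  have "n \<le> card B'"
  proof (rule ccontr)
    assume "\<not> n \<le> card B'"
    then obtain v where v: "v \<in> span X" "v \<noteq> 0" "\<And>e. e \<in> B' \<Longrightarrow> m v e = 0"
      using exists_orthogonal_vector[OF sym_m pB'(1,3) X(1,2)] X(3) by auto
    have "M' * m v v \<le> shifted l y y * m v v"
      using spectral_frameD(2)[OF B' UNIV_I v(3)] y[OF v(1)] by fastforce
    moreover have "shifted l y y < M'" by (simp add: M'_def)
    ultimately show False using m_scaled_le v(2) by blast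
  qed
  then obtain t where t: "t \<in> (\<lambda>e. shifted l e e) ` B'" "card {e \<in> B'. shifted l e e < t} < n"
    "n \<le> card {e \<in> B'. shifted l e e \<le> t}"
    using exists_value_with_count[OF pB'(1) n1, of "\<lambda>e. shifted l e e"] by blast
  have curve: "eigencurve a b m n l = t" by (rule eigencurve_eq[OF B' t])
  have "{e \<in> B. shifted l e e < M} = B"
    using partial_frameD(4)[OF spectral_frameD(1)[OF B]] by auto
  then have "card B
      = (\<Sum>\<nu> | (l, \<nu>) \<in> eigenpoints a b m \<and> \<nu> < M. multiplicity_eigenpoint a b m (l, \<nu>))"
    using eigenvalue_count[OF B, of "\<lambda>\<nu>. \<nu> < M"] by simp
  also have "\<dots> = card {e \<in> B'. shifted l e e < M}"
    by (rule eigenvalue_count[OF B']) (simp add: M'_def)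
  finally have card_B: "card B = card {e \<in> B'. shifted l e e < M}" .
  show ?thesis
  proof
    assume "eigencurve a b m n l < M"
    then have "{e \<in> B'. shifted l e e \<le> t} \<subseteq> {e \<in> B'. shifted l e e < M}" using curve by auto
    then have "card {e \<in> B'. shifted l e e \<le> t} \<le> card {e \<in> B'. shifted l e e < M}"
      using pB'(1) by (intro card_mono) auto
    then show "n \<le> card B" using t(3) card_B by simp
  next
    assume nB: "n \<le> card B"
    show "eigencurve a b m n l < M"
    proof (rule ccontr)
      assume "\<not> eigencurve a b m n l < M"
      then have "{e \<in> B'. shifted l e e < M} \<subseteq> {e \<in> B'. shifted l e e < t}" using curve by auto
      then have "card {e \<in> B'. shifted l e e < M} \<le> card {e \<in> B'. shifted l e e < t}"
        using pB'(1) by (intro card_mono) auto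
      then show False using t(2) card_B nB by simp
    qed
  qed
qed

end

section \<open>One-sided derivatives\<close>

lemma eventually_at_right_by_sequences:
  fixes x :: real
  assumes "\<And>h :: nat \<Rightarrow> real. (\<And>n. 0 < h n) \<Longrightarrow> h \<longlonglongrightarrow> 0 \<Longrightarrow> \<exists>n. P (x + h n)"
  shows "eventually P (at_right x)"
proof (rule ccontr)
  assume "\<not> eventually P (at_right x)"
  then have neg: "\<forall>y>x. \<exists>z>x. z < y \<and> \<not> P z"
    unfolding eventually_at_right[of x "x + 1", simplified] by (meson not_le)
  have "\<exists>z>x. z < x + inverse (real (Suc n)) \<and> \<not> P z" for n
    using neg by (metis less_add_same_cancel1 inverse_positive_iff_positive of_nat_0_less_iff zero_less_Suc)
  then obtain z where z: "\<And>n. x < z n" "\<And>n. z n < x + inverse (real (Suc n))" "\<And>n. \<not> P (z n)"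
    by metis
  have "(\<lambda>n. z n - x) \<longlonglongrightarrow> 0"
  proof (rule tendsto_sandwich[OF _ _ tendsto_const LIMSEQ_inverse_real_of_nat])
    show "\<forall>\<^sub>F n in sequentially. 0 \<le> z n - x" 
      using z(1) by (intro always_eventually allI) (simp add: less_imp_le)
    show "\<forall>\<^sub>F n in sequentially. z n - x \<le> inverse (real (Suc n))"
      using z(2) by (intro always_eventually allI) (simp add: algebra_simps less_imp_le)
  qed
  then have "\<exists>n. P (x + (z n - x))" using z(1) by (intro assms) auto
  then show False using z(3) by simp
qed

context eigencurve_problem
begin

lemma shifted_add: "shifted (l + h) u v = shifted l u v - h * b u v"
  by (simp add: shifted_def algebra_simps)

text \<open>Eigenvectors for different eigenvalues are \<open>m\<close>-orthogonal, and the members of a frame at level \<open>M\<close>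
  have eigenvalues below \<open>M\<close>.\<close>

lemma eigenspace_orthogonal_to_frame:
  assumes B: "spectral_frame (shifted l) UNIV M B" and u: "u \<in> eigenspace a b m (l, M)" and e: "e \<in> B"
  shows "m u e = 0"
proof -
  note pB = partial_frameD[OF spectral_frameD(1)[OF B]]
  have "M * m u e = shifted l e e * m e u"
    using u pB(5)[OF e UNIV_I, of u] symmetric_bilinearD(2)[OF sym_shifted, of l u e]
    by (simp add: mem_eigenspace)
  then have "(M - shifted l e e) * m u e = 0"
    using symmetric_bilinearD(2)[OF sym_m, of e u] by (simp add: algebra_simps)
  then show ?thesis using pB(4)[OF e] by simp
qed

lemma frame_Un_eigenvectors:
  assumes B: "spectral_frame (shifted l) UNIV M B"
    and C: "finite C" "orthonormal_for m C" "C \<subseteq> eigenspace a b m (l, M)"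
  shows "partial_frame (shifted l) UNIV (M + 1) (B \<union> C)" "B \<inter> C = {}"
proof -
  note pB = partial_frameD[OF spectral_frameD(1)[OF B]]
  have orth: "m u e = 0" "m e u = 0" if "u \<in> C" "e \<in> B" for u e
    using eigenspace_orthogonal_to_frame[OF B _ that(2), of u] that C(3)
      symmetric_bilinearD(2)[OF sym_m, of e u] by auto
  have one: "m u u = 1" if "u \<in> C" for u using orthonormal_forD[OF C(2) that that] by simp
  show disj: "B \<inter> C = {}" using orth one by fastforce
  have "orthonormal_for m (B \<union> C)"
    using orth disj pB(3) C(2) unfolding orthonormal_for_def by (metis Un_iff disjoint_iff)
  moreover have "shifted l e e < M + 1 \<and> (\<forall>v. shifted l e v = shifted l e e * m e v)"
    if "e \<in> B \<union> C" for e
  proof (cases "e \<in> B")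
    case True
    then show ?thesis using pB(4)[OF True] pB(5)[OF True UNIV_I] by (metis add_strict_increasing2 less_add_one less_trans)
  next
    case False
    then have e: "e \<in> C" using that by blast
    then have eig: "shifted l e v = M * m e v" for v using C(3) mem_eigenspace by blast
    show ?thesis using eig[of e] one[OF e] by (simp add: eig)
  qed
  ultimately show "partial_frame (shifted l) UNIV (M + 1) (B \<union> C)"
    using pB(1) C(1) finite_Un[of B C] unfolding partial_frame_def by blast
qed

text \<open>The two limit arguments. Both use the expansion of \<open>a - (l + h) b - (M + h s) m\<close> in the parameter
  \<open>h\<close>, whose first-order term is \<open>-h (b + s m)\<close>, along vectors \<open>v\<^sub>j\<close> on which this form has the sign
  that is to be refuted. On these vectors the zeroth-order term has the opposite sign or vanishes, so their
  normalised weak limit is a nonzero eigenvector, and the first-order term decides.\<close>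

lemma no_sequence_above_slope:
  assumes B: "spectral_frame (shifted l) UNIV M B"
    and C: "finite C" "orthonormal_for m C" "C \<subseteq> eigenspace a b m (l, M)"
    and pos: "\<And>x. x \<in> span C \<Longrightarrow> x \<noteq> 0 \<Longrightarrow> - b x x < s * m x x"
    and h: "\<And>j. 0 < h j" "h \<longlonglongrightarrow> 0"
    and v: "\<And>j. v j \<in> span (B \<union> C)" "\<And>j. v j \<noteq> 0"
    and ge: "\<And>j. (M + h j * s) * m (v j) (v j) \<le> shifted (l + h j) (v j) (v j)"
  shows False
proof -
  note pB = partial_frameD[OF spectral_frameD(1)[OF B]]
  note F = frame_Un_eigenvectors(1)[OF B C]
  note pF = partial_frameD[OF F]
  define d where "d x y = b x y + s * m x y" for x y
  have d: "weakly_continuous d" "symmetric_bilinear d"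
    unfolding d_def by (intro weakly_continuous_intros form_intros wc_b wc_m sym_b sym_m)+
  define w where "w x y = l * b x y + M * m x y" for x y
  have w: "weakly_continuous w" "symmetric_bilinear w"
    unfolding w_def by (intro weakly_continuous_intros form_intros wc_b wc_m sym_b sym_m)+
  define x where "x j = (1 / norm (v j)) *\<^sub>R v j" for j
  have x_span: "x j \<in> span (B \<union> C)" for j using v(1) by (simp add: x_def span_scale)
  have first_order: "h j * d (x j) (x j) \<le> shifted l (x j) (x j) - M * m (x j) (x j)" for j
  proof -
    have "h j * d (v j) (v j) \<le> shifted l (v j) (v j) - M * m (v j) (v j)"
      using ge[of j] by (simp add: shifted_add d_def algebra_simps)
    then have "(1 / norm (v j))\<^sup>2 * (h j * d (v j) (v j))
        \<le> (1 / norm (v j))\<^sup>2 * (shifted l (v j) (v j) - M * m (v j) (v j))"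
      by (intro mult_left_mono) auto
    then show ?thesis
      by (simp add: x_def form_simps[OF d(2)] form_simps[OF sym_shifted] form_simps[OF sym_m]
          power2_eq_square right_diff_distrib mult_ac)
  qed
  have eigenvalue_le: "shifted l e e \<le> M" if "e \<in> B \<union> C" for e
  proof (cases "e \<in> B")
    case True then show ?thesis using pB(4) less_imp_le by blast
  next
    case False
    then have "e \<in> C" using that by blast
    then have "shifted l e e = M * m e e" "m e e = 1"
      using C(3) mem_eigenspace orthonormal_forD[OF C(2), of e e] by auto
    then show ?thesis by simp
  qed
  have zeroth: "shifted l y y - M * m y y = (\<Sum>e\<in>B \<union> C. (shifted l e e - M) * (m y e)\<^sup>2)"
    if "y \<in> span (B \<union> C)" for y
    using frame_quadratic[OF sym_shifted subspace_UNIV F order_refl that]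
    by (simp add: sum_distrib_left sum_subtractf left_diff_distrib)
  have terms: "(shifted l e e - M) * (m y e)\<^sup>2 \<le> 0" if "e \<in> B \<union> C" for y e
    using eigenvalue_le[OF that] by (simp add: mult_nonpos_nonneg)
  have le_term: "shifted l y y - M * m y y \<le> (shifted l e e - M) * (m y e)\<^sup>2"
    if "y \<in> span (B \<union> C)" "e \<in> B" for y e
  proof -
    have "(\<Sum>e\<in>B \<union> C - {e}. (shifted l e e - M) * (m y e)\<^sup>2) \<le> 0"
      using terms by (intro sum_nonpos) auto
    then show ?thesis
      using zeroth[OF that(1)] sum.remove[OF pF(1), of e "\<lambda>e. (shifted l e e - M) * (m y e)\<^sup>2"] that(2)
      by simp
  qed
  have le_0: "shifted l y y - M * m y y \<le> 0" if "y \<in> span (B \<union> C)" for y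
    unfolding zeroth[OF that] by (intro sum_nonpos terms)
  have d_le: "d (x j) (x j) \<le> 0" for j
  proof -
    have "h j * d (x j) (x j) \<le> 0" using first_order[of j] le_0[OF x_span[of j]] by linarith
    then show ?thesis using h(1)[of j] by (simp add: mult_le_0_iff)
  qed
  have dom: "a (v j) (v j) \<le> w (v j) (v j) + 0 * d (v j) (v j)" for j
    using le_0[OF v(1)[of j]] by (simp add: shifted_def w_def)
  obtain r z where r: "strict_mono r" and z': "weakly_tendsto (\<lambda>j. (1 / norm (v (r j))) *\<^sub>R v (r j)) z"
    and z: "z \<noteq> 0" "a z z \<le> w z z"
    by (rule compactness_principle[OF w d tendsto_const v(2) dom])
  have lim: "weakly_tendsto (\<lambda>j. x (r j)) z" using z' by (simp add: x_def)
  have hr: "(\<lambda>j. h (r j)) \<longlonglongrightarrow> 0" using LIMSEQ_subseq_LIMSEQ[OF h(2) r] by (simp add: o_def)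
  have dz: "d z z \<le> 0"
    by (rule LIMSEQ_le_const2[OF weakly_continuousD[OF d(1) lim lim]]) (use d_le in blast)
  \<comment> \<open>The components along \<open>B\<close> die out, since the zeroth-order term is at least a quantity of order
    \<open>h\<close> and each such component makes it strictly negative.\<close>
  have orth: "m z e = 0" if e: "e \<in> B" for e
  proof -
    have "(\<lambda>j. h (r j) * d (x (r j)) (x (r j))) \<longlonglongrightarrow> 0 * d z z"
      by (intro tendsto_mult hr weakly_continuousD[OF d(1)] lim)
    moreover have "(\<lambda>j. (shifted l e e - M) * (m (x (r j)) e)\<^sup>2) \<longlonglongrightarrow> (shifted l e e - M) * (m z e)\<^sup>2"
      by (intro tendsto_intros weakly_continuous_left[OF wc_m] lim)
    ultimately have "0 * d z z \<le> (shifted l e e - M) * (m z e)\<^sup>2"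
    proof (rule LIMSEQ_le, intro exI allI impI)
      fix j
      show "h (r j) * d (x (r j)) (x (r j)) \<le> (shifted l e e - M) * (m (x (r j)) e)\<^sup>2"
        using first_order[of "r j"] le_term[OF x_span[of "r j"] e] by linarith
    qed
    then have "0 \<le> (shifted l e e - M) * (m z e)\<^sup>2" by simp
    moreover have "shifted l e e - M < 0" using pB(4)[OF e] by simp
    ultimately have "(m z e)\<^sup>2 \<le> 0" by (simp add: zero_le_mult_iff)
    then show ?thesis by simp
  qed
  have "z \<in> span (B \<union> C)"
    using finite_span_perturbation(2)[OF pF(1) sym_m] _ lim by (rule weakly_closedD) (rule x_span)
  from proj_span[OF sym_m pos_m pF(1,3) this] have "proj m (B \<union> C) z = z" .
  moreover have "proj m (B \<union> C) z \<in> span C"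
    unfolding proj_def
  proof (rule span_sum)
    fix e assume "e \<in> B \<union> C"
    then show "m z e *\<^sub>R e \<in> span C"
      using orth by (cases "e \<in> B") (auto intro: span_zero span_scale span_base)
  qed
  ultimately have "z \<in> span C" by simp
  then show False using pos[of z] z(1) dz by (simp add: d_def)
qed

lemma no_sequence_below_slope:
  assumes B: "spectral_frame (shifted l) UNIV M B"
    and neg: "\<And>x. x \<in> eigenspace a b m (l, M) \<Longrightarrow> (\<And>e. e \<in> D \<Longrightarrow> m x e = 0) \<Longrightarrow> x \<noteq> 0 \<Longrightarrow>
      s * m x x < - b x x"
    and h: "\<And>j. 0 < h j" "h \<longlonglongrightarrow> 0"
    and v: "\<And>j e. e \<in> B \<union> D \<Longrightarrow> m (v j) e = 0" "\<And>j. v j \<noteq> 0"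
    and le: "\<And>j. shifted (l + h j) (v j) (v j) \<le> (M + h j * s) * m (v j) (v j)"
  shows False
proof -
  note pB = partial_frameD[OF spectral_frameD(1)[OF B]]
  define d where "d x y = b x y + s * m x y" for x y
  have d: "weakly_continuous d" "symmetric_bilinear d"
    unfolding d_def by (intro weakly_continuous_intros form_intros wc_b wc_m sym_b sym_m)+
  define w where "w x y = l * b x y + M * m x y" for x y
  have w: "weakly_continuous w" "symmetric_bilinear w"
    unfolding w_def by (intro weakly_continuous_intros form_intros wc_b wc_m sym_b sym_m)+
  have first_order: "shifted l (v j) (v j) - M * m (v j) (v j) \<le> h j * d (v j) (v j)" for j
    using le[of j] by (simp add: shifted_add d_def algebra_simps)
  have d_ge: "0 \<le> d (v j) (v j)" for j
  proof -
    have "M * m (v j) (v j) \<le> shifted l (v j) (v j)"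
      by (rule spectral_frameD(2)[OF B UNIV_I]) (use v(1) in blast)
    then have "0 \<le> h j * d (v j) (v j)" using first_order[of j] by linarith
    then show ?thesis using h(1)[of j] by (simp add: zero_le_mult_iff)
  qed
  have dom: "a (v j) (v j) \<le> w (v j) (v j) + h j * d (v j) (v j)" for j
    using first_order[of j] by (simp add: shifted_def w_def)
  obtain r z where r: "strict_mono r" and z': "weakly_tendsto (\<lambda>j. (1 / norm (v (r j))) *\<^sub>R v (r j)) z"
    and z: "z \<noteq> 0" "a z z \<le> w z z"
    by (rule compactness_principle[OF w d h(2) v(2) dom])
  define x where "x j = (1 / norm (v (r j))) *\<^sub>R v (r j)" for j
  have lim: "weakly_tendsto x z" using z' by (simp add: x_def[abs_def])
  have "0 \<le> d (x j) (x j)" for j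
    using d_ge[of "r j"] by (simp add: x_def form_simps[OF d(2)])
  then have dz: "0 \<le> d z z"
    by (intro LIMSEQ_le_const[OF weakly_continuousD[OF d(1) lim lim]]) blast
  have x_orth: "m (x j) e = 0" if "e \<in> B \<union> D" for j e
    using v(1)[OF that] by (simp add: x_def form_simps[OF sym_m])
  have orth: "m z e = 0" if "e \<in> B \<union> D" for e
    using weakly_continuous_left[OF wc_m lim, of e] x_orth[OF that] by (simp add: LIMSEQ_const_iff)
  let ?q = "\<lambda>u v. shifted l u v - M * m u v"
  have q: "symmetric_bilinear ?q" by (intro form_intros sym_shifted sym_m)
  let ?T = "{v \<in> UNIV. \<forall>e\<in>B. m v e = 0}"
  have T: "subspace ?T" by (rule subspace_orthogonal_part[OF subspace_UNIV])
  \<comment> \<open>The limit minimises the nonnegative form \<open>?q\<close> on the complement of the frame, so \<open>?q z\<close> vanishes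
    there; it vanishes on the frame by orthogonality.\<close>
  have qT: "?q z y = 0" if "y \<in> ?T" for y
  proof (rule form_null_on_subspace[OF q T])
    show "0 \<le> ?q v v" if "v \<in> ?T" for v using spectral_frameD(2)[OF B UNIV_I, of v] that by simp
    show "z \<in> ?T" using orth by simp
    show "?q z z \<le> 0" using z(2) by (simp add: shifted_def w_def)
  qed (rule that)
  have "?q z y = 0" for y
  proof -
    have "y - proj m B y \<in> ?T" using proj_residual_orthogonal[OF sym_m pB(1,3)] by simp
    then have "?q z (y - proj m B y) = 0" by (rule qT)
    moreover have "?q z e = 0" if "e \<in> B" for e
      using pB(5)[OF that UNIV_I, of z] orth[of e] that symmetric_bilinearD(2)[OF sym_m, of e z]
        symmetric_bilinearD(2)[OF sym_shifted, of l e z] by simp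
    then have "?q z (proj m B y) = 0"
      unfolding proj_def form_sum(2)[OF q] form_simps(6)[OF q] by simp
    ultimately show ?thesis using form_simps(4)[OF q, of z y "proj m B y"] by linarith
  qed
  then have "z \<in> eigenspace a b m (l, M)" by (simp add: mem_eigenspace)
  then have "s * m z z < - b z z" using orth z(1) by (intro neg) auto
  then show False using dz by (simp add: d_def)
qed

text \<open>Both bounds on the difference quotient come from counting: the frame \<open>B\<close> below \<open>M\<close> has
  \<open>n0\<close> members, and it is compared with frames at points of the lines of slope \<open>s\<close> through
  \<open>(l, M)\<close>.\<close>

theorem eigencurve_right_derivative:
  assumes dim_E: "dim (eigenspace a b m (l, M)) = k0" and k: "k \<in> {1..k0}"
    and below: "curve_index (UNIV :: 'v set) n0 \<Longrightarrow> eigencurve a b m n0 l < M"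
    and meet: "\<And>k. k \<in> {1..k0} \<Longrightarrow>
      curve_index (UNIV :: 'v set) (n0 + k) \<and> eigencurve a b m (n0 + k) l = M"
  shows "((\<lambda>x. (eigencurve a b m (n0 + k) x - M) / (x - l)) \<longlongrightarrow>
    minmax_quotient b m (eigenspace a b m (l, M)) k) (at_right l)"
proof -
  define E where "E = eigenspace a b m (l, M)"
  have E: "subspace E" unfolding E_def by (rule subspace_eigenspace)
  have curve: "curve_index (UNIV :: 'v set) (n0 + k)" using meet[OF k] by blast
  obtain B where B: "spectral_frame (shifted l) UNIV M B" using shifted_frame_exists by blast
  note pB = partial_frameD[OF spectral_frameD(1)[OF B]]
  have card_B: "card B = n0"
  proof (rule antisym)
    have 1: "1 \<in> {1..k0}" using k by simp
    show "card B \<le> n0" using eigencurve_less_iff[OF _ B, of "n0 + 1"] meet[OF 1] by auto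
    show "n0 \<le> card B"
    proof (cases "n0 = 0")
      case False
      then have n0: "curve_index (UNIV :: 'v set) n0" using curve by (auto simp: curve_index_def)
      then show ?thesis using eigencurve_less_iff[OF n0 B] below by blast
    qed simp
  qed
  obtain X where X: "X \<subseteq> E" "independent X" "E \<subseteq> span X" "card X = k0"
    using basis_exists[of E] dim_E unfolding E_def by metis
  have fX: "finite X" using X(4) k by (intro card_ge_0_finite) simp
  have EX: "E = span X" using X(1,3) span_minimal[OF X(1) E] by blast
  have nb: "symmetric_bilinear (\<lambda>u v. - b u v)" by (intro form_intros sym_b)
  obtain B0 M0 where B0: "partial_frame (\<lambda>u v. - b u v) E M0 B0" "span B0 = E"
    unfolding EX by (rule diagonal_basis_exists[OF fX nb])
  note pB0 = partial_frameD[OF B0(1)]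
  have ind0: "independent B0" by (rule orthonormal_for_independent[OF sym_m pB0(1,3)])
  have card_B0: "card B0 = k0"
  proof -
    have "span B0 = span E" unfolding B0(2)[symmetric] span_span ..
    then have "dim E = card B0" by (rule dim_eq_card[OF _ ind0])
    then show ?thesis using dim_E by (simp add: E_def)
  qed
  have "1 \<le> k" "k \<le> card B0" using card_B0 k by simp_all
  then obtain t where t: "t \<in> (\<lambda>e. - b e e) ` B0" "card {e \<in> B0. - b e e < t} < k"
    "k \<le> card {e \<in> B0. - b e e \<le> t}"
    using exists_value_with_count[OF pB0(1), of k "\<lambda>e. - b e e"] by blast
  have lim_eq: "minmax_quotient b m E k = t" by (rule minmax_quotient_eq[OF sym_b B0 t])
  have sub: "finite C" "orthonormal_for m C" "C \<subseteq> eigenspace a b m (l, M)" "card (B \<union> C) = n0 + card C"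
    "orthonormal_for m (B \<union> C)" "finite (B \<union> C)"
    if "C \<subseteq> B0" for C
  proof -
    show C: "finite C" "orthonormal_for m C" "C \<subseteq> eigenspace a b m (l, M)"
      using that finite_subset[OF that pB0(1)] orthonormal_for_subset[OF pB0(3) that] pB0(2)
      by (auto simp: E_def)
    note F = frame_Un_eigenvectors[OF B C]
    show "card (B \<union> C) = n0 + card C" using card_Un_disjoint[OF pB(1) C(1) F(2)] card_B by simp
    show "orthonormal_for m (B \<union> C)" by (rule partial_frameD(3)[OF F(1)])
    show "finite (B \<union> C)" using pB(1) C(1) by blast
  qed
  show ?thesis
    unfolding E_def[symmetric] lim_eq
  proof (rule order_tendstoI)
    \<comment> \<open>Slopes \<open>s > t\<close>: if the curve stayed on or above the line of slope \<open>s\<close>, the eigenvectors below that line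
      would be fewer than \<open>n0 + k\<close>.\<close>
    fix s assume s: "t < s"
    let ?C = "{e \<in> B0. - b e e \<le> t}"
    have CB0: "?C \<subseteq> B0" by blast
    note C = sub[OF CB0]
    have pos: "- b x x < s * m x x" if x: "x \<in> span ?C" "x \<noteq> 0" for x
    proof -
      have "- b x x = (\<Sum>e\<in>?C. - b e e * (m x e)\<^sup>2)"
        by (rule frame_quadratic(1)[OF nb E B0(1) CB0 x(1)])
      also have "\<dots> \<le> (\<Sum>e\<in>?C. t * (m x e)\<^sup>2)" by (intro sum_mono mult_right_mono) auto
      also have "\<dots> = t * m x x"
        unfolding frame_quadratic(2)[OF nb E B0(1) CB0 x(1)] by (simp add: sum_distrib_left)
      also have "\<dots> < s * m x x" using s pos_m[OF x(2)] by simp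
      finally show ?thesis .
    qed
    show "\<forall>\<^sub>F x in at_right l. (eigencurve a b m (n0 + k) x - M) / (x - l) < s"
    proof (rule eventually_at_right_by_sequences, rule ccontr)
      fix h :: "nat \<Rightarrow> real" assume h: "\<And>n. 0 < h n" "h \<longlonglongrightarrow> 0"
      assume "\<nexists>n. (eigencurve a b m (n0 + k) (l + h n) - M) / (l + h n - l) < s"
      then have "s \<le> (eigencurve a b m (n0 + k) (l + h j) - M) / h j" for j by (simp add: not_less)
      then have above: "M + h j * s \<le> eigencurve a b m (n0 + k) (l + h j)" for j
        unfolding pos_le_divide_eq[OF h(1)] by (simp add: algebra_simps)
      have "\<exists>v. v \<in> span (B \<union> ?C) \<and> v \<noteq> 0 \<and>
          (M + h j * s) * m v v \<le> shifted (l + h j) v v" for j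
      proof -
        obtain B' where B': "spectral_frame (shifted (l + h j)) UNIV (M + h j * s) B'"
          using shifted_frame_exists by blast
        note pB' = partial_frameD[OF spectral_frameD(1)[OF B']]
        have "card B' < n0 + k" using eigencurve_less_iff[OF curve B'] above[of j] by simp
        then have "card B' < card (B \<union> ?C)" using C(4) t(3) by simp
        then obtain v where "v \<in> span (B \<union> ?C)" "v \<noteq> 0" "\<And>e. e \<in> B' \<Longrightarrow> m v e = 0"
          using exists_orthogonal_vector[OF sym_m pB'(1,3)
              orthonormal_for_independent[OF sym_m C(6,5)] C(6)] by blast
        then show ?thesis using spectral_frameD(2)[OF B' UNIV_I] by blast
      qed
      then have "\<exists>v. \<forall>j. v j \<in> span (B \<union> ?C) \<and> v j \<noteq> 0 \<and>
          (M + h j * s) * m (v j) (v j) \<le> shifted (l + h j) (v j) (v j)"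
        by (intro choice allI)
      then obtain v where v: "\<And>j. v j \<in> span (B \<union> ?C)" "\<And>j. v j \<noteq> 0"
        "\<And>j. (M + h j * s) * m (v j) (v j) \<le> shifted (l + h j) (v j) (v j)" by blast
      show False by (rule no_sequence_above_slope[OF B C(1-3) pos h v])
    qed
  next
    \<comment> \<open>Slopes \<open>s < t\<close>; an intermediate slope \<open>s'\<close> makes the curve lie strictly below a line.\<close>
    fix s assume s: "s < t"
    define s' where "s' = (s + t) / 2"
    have s': "s < s'" "s' < t" using s by (simp_all add: s'_def)
    let ?D = "{e \<in> B0. - b e e < t}"
    have DB0: "?D \<subseteq> B0" by blast
    note D = sub[OF DB0]
    have neg: "s' * m x x < - b x x"
      if x: "x \<in> eigenspace a b m (l, M)" "\<And>e. e \<in> ?D \<Longrightarrow> m x e = 0" "x \<noteq> 0" for x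
    proof -
      have xB0: "x \<in> span B0" using x(1) B0(2) by (simp add: E_def)
      have "s' * m x x < t * m x x" using s'(2) pos_m[OF x(3)] by simp
      also have "\<dots> = (\<Sum>e\<in>B0. t * (m x e)\<^sup>2)"
        unfolding frame_quadratic(2)[OF nb E B0(1) order_refl xB0] by (simp add: sum_distrib_left)
      also have "\<dots> \<le> (\<Sum>e\<in>B0. - b e e * (m x e)\<^sup>2)"
      proof (rule sum_mono)
        fix e assume "e \<in> B0"
        then show "t * (m x e)\<^sup>2 \<le> - b e e * (m x e)\<^sup>2"
          using x(2)[of e] mult_right_mono[of t "- b e e" "(m x e)\<^sup>2"]
          by (cases "- b e e < t") auto
      qed
      also have "\<dots> = - b x x"
        by (rule frame_quadratic(1)[OF nb E B0(1) order_refl xB0, symmetric])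
      finally show ?thesis .
    qed
    show "\<forall>\<^sub>F x in at_right l. s < (eigencurve a b m (n0 + k) x - M) / (x - l)"
    proof (rule eventually_at_right_by_sequences, rule ccontr)
      fix h :: "nat \<Rightarrow> real" assume h: "\<And>n. 0 < h n" "h \<longlonglongrightarrow> 0"
      assume "\<nexists>n. s < (eigencurve a b m (n0 + k) (l + h n) - M) / (l + h n - l)"
      then have "(eigencurve a b m (n0 + k) (l + h j) - M) / h j \<le> s" for j by (simp add: not_less)
      then have "eigencurve a b m (n0 + k) (l + h j) \<le> M + h j * s" for j
        unfolding pos_divide_le_eq[OF h(1)] by (simp add: algebra_simps)
      moreover have "M + h j * s < M + h j * s'" for j using s'(1) h(1)[of j] by simp
      ultimately have under: "eigencurve a b m (n0 + k) (l + h j) < M + h j * s'" for j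
        by (rule le_less_trans)
      have "\<exists>v. v \<noteq> 0 \<and> (\<forall>e\<in>B \<union> ?D. m v e = 0) \<and>
          shifted (l + h j) v v \<le> (M + h j * s') * m v v" for j
      proof -
        obtain B' where B': "spectral_frame (shifted (l + h j)) UNIV (M + h j * s') B'"
          using shifted_frame_exists by blast
        note pB' = partial_frameD[OF spectral_frameD(1)[OF B']]
        have "n0 + k \<le> card B'" using eigencurve_less_iff[OF curve B'] under[of j] by simp
        then have "card (B \<union> ?D) < card B'" using D(4) t(2) by simp
        then obtain v where v: "v \<in> span B'" "v \<noteq> 0" "\<forall>e\<in>B \<union> ?D. m v e = 0"
          using exists_orthogonal_vector[OF sym_m D(6,5)
              orthonormal_for_independent[OF sym_m pB'(1,3)] pB'(1)] by blast
        note fq = frame_quadratic[OF sym_shifted subspace_UNIV spectral_frameD(1)[OF B'] order_refl v(1)]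
        have "shifted (l + h j) v v \<le> (\<Sum>e\<in>B'. (M + h j * s') * (m v e)\<^sup>2)"
          unfolding fq(1) using pB'(4) by (intro sum_mono mult_right_mono) (auto intro: less_imp_le)
        also have "\<dots> = (M + h j * s') * m v v" unfolding fq(2) by (simp add: sum_distrib_left)
        finally show ?thesis using v(2,3) by blast
      qed
      then have "\<exists>v. \<forall>j. v j \<noteq> 0 \<and> (\<forall>e\<in>B \<union> ?D. m (v j) e = 0) \<and>
          shifted (l + h j) (v j) (v j) \<le> (M + h j * s') * m (v j) (v j)"
        by (intro choice allI)
      then obtain v where v: "\<And>j. v j \<noteq> 0" "\<And>j e. e \<in> B \<union> ?D \<Longrightarrow> m (v j) e = 0"
        "\<And>j. shifted (l + h j) (v j) (v j) \<le> (M + h j * s') * m (v j) (v j)" by blast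
      show False by (rule no_sequence_below_slope[OF B neg h v(2,1,3)])
    qed
  qed
qed

end

text \<open>The reflection \<open>(\<lambda>, b) \<mapsto> (-\<lambda>, -b)\<close> preserves eigenvectors, so it turns left derivatives
  into right ones.\<close>

lemma eigenspace_reflect:
  "eigenspace a (\<lambda>u v. - b u v) m (- l, M) = eigenspace a b m (l, M)"
  by (simp add: eigenspace_def)

lemma eigencurve_reflect:
  "eigencurve a (\<lambda>u v. - b u v) m n (- l) = eigencurve a b m n l"
proof -
  have "(- l, \<mu>) \<in> eigenpoints a (\<lambda>u v. - b u v) m \<longleftrightarrow> (l, \<mu>) \<in> eigenpoints a b m" for \<mu>
    by (simp add: eigenpoints_def add.commute)
  then show ?thesis
    unfolding eigencurve_def multiplicity_eigenpoint_def eigenspace_reflect by simp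
qed

theorem theorem7p1:
  fixes a b m :: "'v::{real_inner, complete_space} \<Rightarrow> 'v \<Rightarrow> real"
    and ls ms :: real and n0 k0 :: nat
  assumes "separable_space (euclidean :: 'v topology)"
    and "symmetric_bilinear a" and "symmetric_bilinear b" and "symmetric_bilinear m"
    and "continuous_coercive a"
    and "weakly_continuous b"
    and "weakly_continuous m"
    and "\<And>u. u \<noteq> 0 \<Longrightarrow> m u u > 0"
    and "(ls, ms) \<in> eigenpoints a b m"
    and "multiplicity_eigenpoint a b m (ls, ms) = k0"
    and "k0 \<ge> 2"
    and "curve_index (UNIV :: 'v set) n0 \<Longrightarrow> eigencurve a b m n0 ls < ms"
    and "\<And>k. k \<in> {1..k0} \<Longrightarrow>
           curve_index (UNIV :: 'v set) (n0 + k) \<and> eigencurve a b m (n0 + k) ls = ms"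
    and "curve_index (UNIV :: 'v set) (n0 + k0 + 1) \<Longrightarrow> ms < eigencurve a b m (n0 + k0 + 1) ls"
  shows "\<forall>k\<in>{1..k0}.
      ((\<lambda>l. (eigencurve a b m (n0 + k) l - ms) / (l - ls)) \<longlongrightarrow>
          minmax_quotient b m (eigenspace a b m (ls, ms)) (k0 - k + 1)) (at_left ls) \<and>
      ((\<lambda>l. (eigencurve a b m (n0 + k) l - ms) / (l - ls)) \<longlongrightarrow>
          minmax_quotient b m (eigenspace a b m (ls, ms)) k) (at_right ls)"
proof (intro ballI conjI)
  fix k assume k: "k \<in> {1..k0}"
  let ?E = "eigenspace a b m (ls, ms)" and ?nb = "\<lambda>u v. - b u v"
  interpret eigencurve_problem a m b
    using assms(1-8) by unfold_locales
  interpret reflected: eigencurve_problem a m ?nb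
    by unfold_locales (intro form_intros weakly_continuous_intros sym_b wc_b)+
  have dim_E: "dim ?E = k0" using assms(10) by (simp add: multiplicity_eigenpoint_def)
  show "((\<lambda>l. (eigencurve a b m (n0 + k) l - ms) / (l - ls)) \<longlongrightarrow> minmax_quotient b m ?E k) (at_right ls)"
    by (rule eigencurve_right_derivative[OF dim_E k assms(12,13)])
  obtain X where X: "X \<subseteq> ?E" "?E \<subseteq> span X" "card X = k0"
    using basis_exists[of ?E] dim_E by metis
  have EX: "?E = span X" using X(2) span_minimal[OF X(1) subspace_eigenspace] by blast
  have fX: "finite X" using X(3) k by (intro card_ge_0_finite) simp
  have minus: "minmax_quotient ?nb m ?E k = - minmax_quotient b m ?E (k0 - k + 1)"
    using minmax_quotient_minus[OF fX sym_b, of k] k dim_E unfolding EX by simp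
  have "((\<lambda>x. (eigencurve a ?nb m (n0 + k) x - ms) / (x - - ls)) \<longlongrightarrow>
      minmax_quotient ?nb m (eigenspace a ?nb m (- ls, ms)) k) (at_right (- ls))"
    by (rule reflected.eigencurve_right_derivative[OF _ k])
       (use dim_E assms(12,13) in \<open>simp_all add: eigenspace_reflect eigencurve_reflect\<close>)
  then have "((\<lambda>x. (eigencurve a ?nb m (n0 + k) x - ms) / (x - - ls)) \<longlongrightarrow>
      - minmax_quotient b m ?E (k0 - k + 1)) (at_right (- ls))"
    by (simp only: eigenspace_reflect minus)
  then have "((\<lambda>x. - ((eigencurve a ?nb m (n0 + k) x - ms) / (x - - ls))) \<longlongrightarrow>
      minmax_quotient b m ?E (k0 - k + 1)) (at_right (- ls))"
    using tendsto_minus by fastforce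
  moreover have "- ((eigencurve a ?nb m (n0 + k) x - ms) / (x - - ls))
      = (eigencurve a b m (n0 + k) (- x) - ms) / (- x - ls)" for x
  proof -
    have "- x - ls = - (x - - ls)" by simp
    then show ?thesis
      using eigencurve_reflect[of a b m "n0 + k" "- x"] by (simp only: minus_minus minus_divide_right)
  qed
  ultimately show "((\<lambda>l. (eigencurve a b m (n0 + k) l - ms) / (l - ls)) \<longlongrightarrow>
      minmax_quotient b m ?E (k0 - k + 1)) (at_left ls)"
    unfolding filterlim_at_left_to_right by simp
qed

end
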